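(* Let $X\in\mathbb{R}^{n\times p}$ with $X\ne0$, $y\in\mathbb{R}^n$, $\lambda_2>0$, $k\in\mathbb{N}$, $M>0$, and let $(\mathcal{J}_0,\mathcal{J}_1,\mathcal{J}_f)$ be a partition of $[p]=\{1,\dots,p\}$ with $|\mathcal{J}_1|\le k$. Let $f:\mathbb{R}^n\times\mathbb{R}^n\to\mathbb{R}$ be such that $F(z):=f(z,y)$ is strictly convex, locally smooth and firmly convex in $z$. Let $G(\beta):=2\lambda_2\,g_{\mathcal{N}}(\beta)$, where $$g_{\mathcal{N}}(\beta):=\inf_{z\in\mathbb{R}^p}\Big\{\tfrac12\sum_{j\in[p]}\beta_j^2/z_j\ :\ (\beta,z)\in\mathcal{D}\Big\}$$ and $\mathcal{D}$ is the set of $(\beta,z)\in\mathbb{R}^{2p}$ with $\mathbf{1}^\top z\le k$, $|\beta_j|\le Mz_j$ for all $j\in[p]$, $z_j=0$ for $j\in\mathcal{J}_0$, $z_j=1$ for $j\in\mathcal{J}_1$, and $z_j\in[0,1]$ for $j\in\mathcal{J}_f$. Let $\Phi(\beta)=F(X\beta)+G(\beta)$ and $\Psi(\zeta)=-F^*(-\zeta)-G^*(X^\top\zeta)$. Then all of the following hold. (A) $F$ is convex and locally smooth, $G$ is proper, closed and convex, and there are no lines along which $F$ or $G$ is finite and affine. (B) $\operatorname{ri}(\operatorname{dom}\Phi)$ and $\operatorname{int}(\operatorname{dom}\Psi)$ are nonempty; specifically there exist $\beta_s\in\mathbb{R}^p$, $\zeta_s\in\mathbb{R}^n$ with $\beta_s\in\operatorname{ri}(\operatorname{dom}G)$,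 $X\beta_s\in\operatorname{int}(\operatorname{dom}F)$, $-\zeta_s\in\operatorname{int}(\operatorname{dom}F^* )$, $X^\top\zeta_s\in\operatorname{int}(\operatorname{dom}G^* )$. (C) With $\mathcal{B}^\star$ the set of minimizers of $\Phi$ and $\zeta^\star$ the unique maximizer of $\Psi$: (i) $\mathcal{B}^\star$ is compact and $X\mathcal{B}^\star\subset\operatorname{int}(\operatorname{dom}F)$; (ii) $F$ and $G$ are firmly convex relative to $-\zeta^\star$ and $X^\top\zeta^\star$, respectively; (iii) $\partial F^*(-\zeta^\star)$ and $\partial G^*(X^\top\zeta^\star)$ are polyhedral sets; (iv) $-\zeta^\star\in\operatorname{int}(\operatorname{dom}F^* )$ and $X^\top\zeta^\star\in\operatorname{int}(\operatorname{dom}G^* )$. (D) $F$ is strictly convex.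
   Context: Conventions: $\beta_j^2/z_j$ is $0$ if $\beta_j=z_j=0$ and $+\infty$ if $\beta_j\ne0$, $z_j=0$; the infimum over an empty set is $+\infty$; $h^*(\alpha)=\sup_\beta\{\beta^\top\alpha-h(\beta)\}$; closed means closed epigraph. Locally smooth: $\nabla h$ exists and is Lipschitz continuous on every compact subset of $\operatorname{int}(\operatorname{dom}h)$. "There are no lines along which $h$ is finite and affine": there are no $x$ and $d\neq0$ such that $t\mapsto h(x+td)$ is finite and affine on $\mathbb{R}$. Firmly convex: a proper, closed, convex $h$ is firmly convex relative to $\nu$ if, with $h_\nu(\beta):=h(\beta)-\nu^\top\beta$, for any compact set $\mathcal{K}$ there is $\kappa>0$ with $h_\nu(\beta)\ge\inf h_\nu+\frac{\kappa}{2}\operatorname{dist}^2\big(\beta,(\partial h_\nu)^{-1}(0)\big)$ for all $\beta\in\mathcal{K}$, where $(\partial h_\nu)^{-1}(0)$ is the set of minimizers of $h_\nu$ and $\operatorname{dist}$ is Euclidean distance to a set. $h$ is firmly convex if it is firmly convex relative to every $\nu$ for which $(\partial h_\nu)^{-1}(0)$ is nonempty. Given (A) and (B), both the problem $\inf\Phi$ and the problem $\sup\Psi$ have optimal solutions with equal optimal values, and the maximizer of $\Psi$ is unique, so $\zeta^\star$ in (C) is well defined. *)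

theory Defs
  imports "HOL-Analysis.Analysis"
begin

definition effdom :: "('a \<Rightarrow> ereal) \<Rightarrow> 'a set" where
  "effdom h = {x. h x < \<infinity>}"

(* The library's epigraph is for real-valued functions on a set. *)
definition epi :: "('a \<Rightarrow> ereal) \<Rightarrow> ('a \<times> real) set" where
  "epi h = {xr. h (fst xr) \<le> ereal (snd xr)}"

definition proper_fun :: "('a \<Rightarrow> ereal) \<Rightarrow> bool" where
  "proper_fun h \<longleftrightarrow> (\<forall>x. h x \<noteq> -\<infinity>) \<and> (\<exists>x. h x < \<infinity>)"

definition closed_fun :: "('a::topological_space \<Rightarrow> ereal) \<Rightarrow> bool" where
  "closed_fun h \<longleftrightarrow> closed (epi h)"

definition convex_fun :: "('a::real_vector \<Rightarrow> ereal) \<Rightarrow> bool" where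
  "convex_fun h \<longleftrightarrow> convex (epi h)"

definition strictly_convex_fun :: "('a::real_vector \<Rightarrow> ereal) \<Rightarrow> bool" where
  "strictly_convex_fun h \<longleftrightarrow>
     (\<forall>x\<in>effdom h. \<forall>y\<in>effdom h. \<forall>t::real. x \<noteq> y \<longrightarrow> 0 < t \<longrightarrow> t < 1 \<longrightarrow>
        h ((1 - t) *\<^sub>R x + t *\<^sub>R y) < ereal (1 - t) * h x + ereal t * h y)"

definition conjugate_fun :: "('a::real_inner \<Rightarrow> ereal) \<Rightarrow> 'a \<Rightarrow> ereal" where
  "conjugate_fun h \<alpha> = (SUP \<beta>. ereal (\<beta> \<bullet> \<alpha>) - h \<beta>)"

definition subdiff :: "('a::real_inner \<Rightarrow> ereal) \<Rightarrow> 'a \<Rightarrow> 'a set" where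
  "subdiff h x = {v. \<forall>y. h x + ereal (v \<bullet> (y - x)) \<le> h y}"

definition minimizers :: "('a \<Rightarrow> ereal) \<Rightarrow> 'a set" where
  "minimizers h = {x. \<forall>y. h x \<le> h y}"

definition maximizers :: "('a \<Rightarrow> ereal) \<Rightarrow> 'a set" where
  "maximizers h = {x. \<forall>y. h y \<le> h x}"

(* real_of_ereal is meaningful here because finiteness at every interior point is demanded;
   interior points have a whole neighbourhood inside the interior. *)
definition locally_smooth :: "('a::euclidean_space \<Rightarrow> ereal) \<Rightarrow> bool" where
  "locally_smooth h \<longleftrightarrow>
     (\<exists>g :: 'a \<Rightarrow> 'a.
        (\<forall>x\<in>interior (effdom h). \<bar>h x\<bar> \<noteq> \<infinity> \<and> (GDERIV (\<lambda>u. real_of_ereal (h u)) x :> g x)) \<and>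
        (\<forall>K. compact K \<longrightarrow> K \<subseteq> interior (effdom h) \<longrightarrow> (\<exists>L. L-lipschitz_on K g)))"

definition no_affine_lines :: "('a::real_vector \<Rightarrow> ereal) \<Rightarrow> bool" where
  "no_affine_lines h \<longleftrightarrow>
     \<not> (\<exists>x d. d \<noteq> 0 \<and> (\<exists>a b :: real. \<forall>t :: real. h (x + t *\<^sub>R d) = ereal (a + b * t)))"

definition tilt :: "('a::real_inner \<Rightarrow> ereal) \<Rightarrow> 'a \<Rightarrow> 'a \<Rightarrow> ereal" where
  "tilt h \<nu> \<beta> = h \<beta> - ereal (\<nu> \<bullet> \<beta>)"

definition subdiff_zeros :: "('a::real_inner \<Rightarrow> ereal) \<Rightarrow> 'a set" where
  "subdiff_zeros h = {\<beta>. 0 \<in> subdiff h \<beta>}"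

(* Unlike the library's infdist, the distance to the empty set is infinite. *)
definition set_distance :: "'a::metric_space \<Rightarrow> 'a set \<Rightarrow> ereal" where
  "set_distance x S = (INF s\<in>S. ereal (dist x s))"

definition firmly_convex_rel :: "('a::euclidean_space \<Rightarrow> ereal) \<Rightarrow> 'a \<Rightarrow> bool" where
  "firmly_convex_rel h \<nu> \<longleftrightarrow>
     proper_fun h \<and> closed_fun h \<and> convex_fun h \<and>
     (\<forall>K. compact K \<longrightarrow> (\<exists>\<kappa>>0. \<forall>\<beta>\<in>K.
        tilt h \<nu> \<beta> \<ge>
          (INF u. tilt h \<nu> u) + ereal (\<kappa> / 2) * (set_distance \<beta> (subdiff_zeros (tilt h \<nu>)))\<^sup>2))"

definition firmly_convex :: "('a::euclidean_space \<Rightarrow> ereal) \<Rightarrow> bool" where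
  "firmly_convex h \<longleftrightarrow>
     proper_fun h \<and> closed_fun h \<and> convex_fun h \<and>
     (\<forall>\<nu>. subdiff_zeros (tilt h \<nu>) \<noteq> {} \<longrightarrow> firmly_convex_rel h \<nu>)"

definition quad_over_lin :: "real \<Rightarrow> real \<Rightarrow> ereal" where
  "quad_over_lin b z = (if z = 0 then (if b = 0 then 0 else \<infinity>) else ereal (b\<^sup>2 / z))"

definition node_domain ::
    "nat \<Rightarrow> real \<Rightarrow> 'p::finite set \<Rightarrow> 'p set \<Rightarrow> 'p set \<Rightarrow> ((real^'p) \<times> (real^'p)) set" where
  "node_domain k M J0 J1 Jf =
     {(\<beta>, z). (\<Sum>j\<in>UNIV. z $ j) \<le> real k \<and> (\<forall>j. \<bar>\<beta> $ j\<bar> \<le> M * z $ j) \<and>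
              (\<forall>j\<in>J0. z $ j = 0) \<and> (\<forall>j\<in>J1. z $ j = 1) \<and> (\<forall>j\<in>Jf. 0 \<le> z $ j \<and> z $ j \<le> 1)}"

definition g_node ::
    "nat \<Rightarrow> real \<Rightarrow> 'p::finite set \<Rightarrow> 'p set \<Rightarrow> 'p set \<Rightarrow> real^'p \<Rightarrow> ereal" where
  "g_node k M J0 J1 Jf \<beta> =
     (INF z \<in> {z. (\<beta>, z) \<in> node_domain k M J0 J1 Jf}.
        ereal (1 / 2) * (\<Sum>j\<in>UNIV. quad_over_lin (\<beta> $ j) (z $ j)))"

definition primal_obj ::
    "(real^'n \<Rightarrow> ereal) \<Rightarrow> (real^'p \<Rightarrow> ereal) \<Rightarrow> real^'p^'n \<Rightarrow> real^'p \<Rightarrow> ereal" where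
  "primal_obj F G X \<beta> = F (X *v \<beta>) + G \<beta>"

definition dual_obj ::
    "(real^'n \<Rightarrow> ereal) \<Rightarrow> (real^'p \<Rightarrow> ereal) \<Rightarrow> real^'p^'n \<Rightarrow> real^'n \<Rightarrow> ereal" where
  "dual_obj F G X \<zeta> = - conjugate_fun F (- \<zeta>) - conjugate_fun G (transpose X *v \<zeta>)"

end

theory Submission
  imports Defs
begin

text \<open>Since \<open>dom G\<close> is bounded and \<open>F\<close> is finite, \<open>\<Phi>\<close> has a minimiser \<open>\<beta>\<close>, and first-order
  optimality shows that \<open>\<zeta> = - \<nabla>F (X \<beta>)\<close> attains equality in both Fenchel--Young inequalities;
  hence it is a dual solution, and every dual solution is of this form. Strict convexity
  makes \<open>X \<beta>\<close> the only minimiser of the tilt of \<open>F\<close>, which then grows linearly away from \<open>X \<beta>\<close>, so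
  \<open>- \<zeta>\<close> is interior to \<open>dom F\<^sup>*\<close> and \<open>\<partial>F\<^sup>* (- \<zeta>)\<close> is a point. For \<open>G\<close> the tilt by any \<open>\<alpha>\<close> can be
  minimised over \<open>\<beta>\<close> first: for given \<open>z\<close> the optimum is \<open>\<beta>\<^sub>j = z\<^sub>j u\<^sub>j\<close> with \<open>u\<close> the clipping of
  \<open>\<alpha> / 2\<lambda>\<^sub>2\<close> to \<open>[-M, M]\<close>, and the value is linear in \<open>z\<close>. So the minimisers are a linear image of a
  face of the polytope of admissible \<open>z\<close>; strong convexity in \<open>u\<close> and the sharpness of linear
  programs give the quadratic growth.\<close>

section \<open>Conjugates and tilts\<close>

lemma subdiff_zeros_eq_minimizers: "subdiff_zeros h = minimizers h"
  by (simp add: subdiff_zeros_def subdiff_def minimizers_def zero_ereal_def[symmetric])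

lemma fenchel_young: "ereal (\<beta> \<bullet> \<alpha>) - h \<beta> \<le> conjugate_fun h \<alpha>"
  unfolding conjugate_fun_def by (rule SUP_upper) simp

text \<open>The conjugate is minus the infimum of the tilt. With a real \<open>c\<close> this form
  also covers infinite values, so bounds on conjugates can be proved on tilts.\<close>

lemma conjugate_le_iff_tilt: "conjugate_fun h \<alpha> \<le> ereal c \<longleftrightarrow> (\<forall>\<beta>. ereal (- c) \<le> tilt h \<alpha> \<beta>)"
proof -
  have "ereal (\<beta> \<bullet> \<alpha>) - h \<beta> \<le> ereal c \<longleftrightarrow> ereal (- c) \<le> tilt h \<alpha> \<beta>" for \<beta>
    by (cases "h \<beta>") (auto simp: tilt_def inner_commute)
  then show ?thesis
    by (simp add: conjugate_fun_def SUP_le_iff)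
qed

lemma conjugate_eq_at_minimizer:
  assumes "v \<in> minimizers (tilt h \<alpha>)" and "h v = ereal r"
  shows "conjugate_fun h \<alpha> = ereal (\<alpha> \<bullet> v - r)"
proof (rule antisym)
  show "conjugate_fun h \<alpha> \<le> ereal (\<alpha> \<bullet> v - r)"
    using assms by (auto simp: conjugate_le_iff_tilt minimizers_def tilt_def)
  show "ereal (\<alpha> \<bullet> v - r) \<le> conjugate_fun h \<alpha>"
    using fenchel_young[of v \<alpha> h] assms by (simp add: inner_commute)
qed

section \<open>Affine minorants and the biconjugate\<close>

lemma epi_strict_separation:
  fixes h :: "'a::euclidean_space \<Rightarrow> ereal"
  assumes "proper_fun h" "closed_fun h" "convex_fun h" and r: "ereal r < h x"
  obtains a s b where "s \<ge> 0" "a \<bullet> x + s * r < b"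
    "\<And>\<beta> v. h \<beta> \<le> ereal v \<Longrightarrow> b < a \<bullet> \<beta> + s * v"
proof -
  have "closed (epi h)" "convex (epi h)" "(x, r) \<notin> epi h"
    using assms by (auto simp: closed_fun_def convex_fun_def epi_def)
  then obtain a' b where a': "a' \<bullet> (x, r) < b" "\<forall>w\<in>epi h. a' \<bullet> w > b"
    using separating_hyperplane_closed_point by metis
  obtain a s where as: "a' = (a, s)" by fastforce
  have above: "b < a \<bullet> \<beta> + s * v" if "h \<beta> \<le> ereal v" for \<beta> v
    using a'(2) that by (auto simp: as epi_def)
  obtain \<beta>0 r0 where \<beta>0: "h \<beta>0 = ereal r0"
    using assms(1) unfolding proper_fun_def by (metis ereal_cases less_irrefl)
  \<comment> \<open>The epigraph is unbounded upwards, so with a negative \<open>s\<close> a large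
    height \<open>v\<close> would violate the separation.\<close>
  have "s \<ge> 0"
  proof (rule ccontr)
    assume "\<not> 0 \<le> s"
    define v where "v = max r0 ((b - a \<bullet> \<beta>0) / s)"
    have "s * v \<le> b - a \<bullet> \<beta>0"
      using mult_left_mono_neg[of "(b - a \<bullet> \<beta>0) / s" v s] \<open>\<not> 0 \<le> s\<close> by (simp add: v_def)
    moreover have "h \<beta>0 \<le> ereal v" by (simp add: \<beta>0 v_def)
    ultimately show False using above[of \<beta>0 v] by simp
  qed
  then show ?thesis using that[of s a b] a'(1) above by (simp add: as)
qed

text \<open>Dividing a non-vertical separating hyperplane by \<open>s\<close> gives an affine
  function below \<open>h\<close>; the bound on the conjugate encodes its slope and
  constant.\<close>

lemma affine_minorant_of_separation:
  fixes h :: "'a::euclidean_space \<Rightarrow> ereal"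
  assumes "s > 0" and "\<And>\<beta> v. h \<beta> \<le> ereal v \<Longrightarrow> b < a \<bullet> \<beta> + s * v" and "\<And>\<beta>. h \<beta> \<noteq> -\<infinity>"
  shows "conjugate_fun h (- (a /\<^sub>R s)) \<le> ereal (- (b / s))"
  unfolding conjugate_le_iff_tilt
proof
  fix \<beta>
  show "ereal (- (- (b / s))) \<le> tilt h (- (a /\<^sub>R s)) \<beta>"
  proof (cases "h \<beta>")
    case (real v)
    then have "b < a \<bullet> \<beta> + s * v" by (simp add: assms(2))
    then show ?thesis using \<open>s > 0\<close> by (simp add: real tilt_def field_simps)
  qed (use assms(3) in \<open>auto simp: tilt_def\<close>)
qed

text \<open>The hard half of the Fenchel-Moreau theorem. Every real number below \<open>h x\<close>
  is reached at \<open>x\<close> by an affine minorant, whose slope then competes in the supremum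
  defining the biconjugate.\<close>

lemma le_biconjugate:
  fixes h :: "'a::euclidean_space \<Rightarrow> ereal"
  assumes h: "proper_fun h" "closed_fun h" "convex_fun h"
  shows "h x \<le> conjugate_fun (conjugate_fun h) x"
proof (rule ereal_le_real)
  have ninf: "h \<beta> \<noteq> -\<infinity>" for \<beta> using h(1) by (simp add: proper_fun_def)
  have minorant: "\<exists>\<alpha> c. conjugate_fun h \<alpha> \<le> ereal c \<and> r \<le> \<alpha> \<bullet> x - c" if r: "ereal r < h x" for r x
  proof -
    obtain x0 r0 where x0: "h x0 = ereal r0"
      using h(1) unfolding proper_fun_def by (metis ereal_cases less_irrefl)
    \<comment> \<open>A hyperplane separating a point just below the graph over the domain point
      \<open>x0\<close> cannot be vertical, so \<open>s0 > 0\<close> and at least one affine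
      minorant exists.\<close>
    have lt: "ereal (r0 - 1) < h x0" by (simp add: x0)
    obtain a0 s0 b0 where 0: "s0 \<ge> 0" "a0 \<bullet> x0 + s0 * (r0 - 1) < b0"
      "\<And>\<beta> v. h \<beta> \<le> ereal v \<Longrightarrow> b0 < a0 \<bullet> \<beta> + s0 * v"
      using epi_strict_separation[OF h lt] by metis
    have "b0 < a0 \<bullet> x0 + s0 * r0" using 0(3)[of x0 r0] x0 by simp
    with 0(1,2) have "s0 > 0" by (cases "s0 = 0") (auto simp: algebra_simps)
    then obtain \<alpha>0 c0 where m0: "conjugate_fun h \<alpha>0 \<le> ereal c0"
      using affine_minorant_of_separation[of s0 h b0 a0, OF _ 0(3) ninf] by blast
    obtain a s b where 1: "s \<ge> 0" "a \<bullet> x + s * r < b"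
      "\<And>\<beta> v. h \<beta> \<le> ereal v \<Longrightarrow> b < a \<bullet> \<beta> + s * v"
      using epi_strict_separation[OF h r] by metis
    show ?thesis
    proof (cases "s > 0")
      case True
      show ?thesis
        using affine_minorant_of_separation[of s h b a, OF True 1(3) ninf] 1(2) True
        by (intro exI[of _ "- (a /\<^sub>R s)"] exI[of _ "- (b / s)"]) (auto simp: field_simps)
    next
      case False
      \<comment> \<open>A vertical separating hyperplane is tilted by adding a large multiple of it to \<open>\<alpha>0\<close>.\<close>
      with 1(1) have "s = 0" by simp
      have gap: "b - a \<bullet> x > 0" using 1(2) \<open>s = 0\<close> by simp
      \<comment> \<open>The added term \<open>t * (b - a \<bullet> x)\<close> has to cover the
        shortfall of the first minorant at \<open>x\<close>.\<close>
      define t where "t = \<bar>r - (\<alpha>0 \<bullet> x - c0)\<bar> / (b - a \<bullet> x)"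
      have t: "t \<ge> 0" "t * (b - a \<bullet> x) = \<bar>r - (\<alpha>0 \<bullet> x - c0)\<bar>" using gap by (auto simp: t_def)
      have "ereal (- (c0 - t * b)) \<le> tilt h (\<alpha>0 - t *\<^sub>R a) \<beta>" for \<beta>
      proof (cases "h \<beta>")
        case (real v)
        have "b < a \<bullet> \<beta>" using 1(3)[of \<beta> v] real \<open>s = 0\<close> by simp
        then have "t * b \<le> t * (a \<bullet> \<beta>)" using t(1) by (simp add: mult_left_mono)
        moreover have "- c0 \<le> v - \<alpha>0 \<bullet> \<beta>"
          using m0[unfolded conjugate_le_iff_tilt, rule_format, of \<beta>] real by (simp add: tilt_def)
        ultimately show ?thesis by (simp add: real tilt_def inner_diff_left)
      qed (use ninf in \<open>auto simp: tilt_def\<close>)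
      moreover have "r \<le> (\<alpha>0 - t *\<^sub>R a) \<bullet> x - (c0 - t * b)"
        using t(2) by (simp add: inner_diff_left algebra_simps)
      ultimately show ?thesis unfolding conjugate_le_iff_tilt by blast
    qed
  qed
  show "h x \<le> ereal q" if q: "conjugate_fun (conjugate_fun h) x \<le> ereal q" for q
  proof (rule ccontr)
    assume "\<not> h x \<le> ereal q"
    then obtain r where r: "ereal q < ereal r" "ereal r < h x"
      using ereal_dense2[of "ereal q" "h x"] by (auto simp: not_le)
    obtain \<alpha> c where "conjugate_fun h \<alpha> \<le> ereal c" "r \<le> \<alpha> \<bullet> x - c" using minorant[OF r(2)] by blast
    then have "ereal r \<le> ereal (\<alpha> \<bullet> x) - conjugate_fun h \<alpha>"
      by (cases "conjugate_fun h \<alpha>") auto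
    also have "\<dots> \<le> ereal q" using fenchel_young q by (rule order_trans)
    finally show False using r(1) by simp
  qed
qed

text \<open>Both sides express equality in the Fenchel-Young inequality; the inclusion from left to
  right uses the biconjugate. Part (C)(iii) thereby becomes a statement about sets of
  minimizers.\<close>

lemma subdiff_conjugate_eq_minimizers:
  fixes h :: "'a::euclidean_space \<Rightarrow> ereal"
  assumes h: "proper_fun h" "closed_fun h" "convex_fun h" and fin: "conjugate_fun h \<alpha> < \<infinity>"
  shows "subdiff (conjugate_fun h) \<alpha> = minimizers (tilt h \<alpha>)"
proof -
  obtain x0 r0 where x0: "h x0 = ereal r0"
    using h(1) unfolding proper_fun_def by (metis ereal_cases less_irrefl)
  obtain c where c: "conjugate_fun h \<alpha> = ereal c"
    using fin fenchel_young[of x0 \<alpha> h] x0 by (cases "conjugate_fun h \<alpha>") auto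
  show ?thesis
  proof (intro equalityI subsetI)
    fix v assume "v \<in> subdiff (conjugate_fun h) \<alpha>"
    then have v: "ereal c + ereal (v \<bullet> (\<alpha>' - \<alpha>)) \<le> conjugate_fun h \<alpha>'" for \<alpha>'
      by (simp add: subdiff_def c)
    have "ereal (\<alpha>' \<bullet> v) - conjugate_fun h \<alpha>' \<le> ereal (\<alpha> \<bullet> v - c)" for \<alpha>'
      using v[of \<alpha>'] by (cases "conjugate_fun h \<alpha>'") (auto simp: inner_diff_right inner_commute)
    then have "conjugate_fun (conjugate_fun h) v \<le> ereal (\<alpha> \<bullet> v - c)"
      unfolding conjugate_fun_def[of "conjugate_fun h"] by (rule SUP_least)
    then have "h v \<le> ereal (\<alpha> \<bullet> v - c)" using le_biconjugate[OF h] order_trans by blast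
    then have "tilt h \<alpha> v \<le> ereal (- c)" by (cases "h v") (auto simp: tilt_def)
    moreover have "ereal (- c) \<le> tilt h \<alpha> \<beta>" for \<beta>
      using conjugate_le_iff_tilt[of h \<alpha> c] c by simp
    ultimately show "v \<in> minimizers (tilt h \<alpha>)"
      unfolding minimizers_def using order_trans by blast
  next
    fix v assume v: "v \<in> minimizers (tilt h \<alpha>)"
    have "tilt h \<alpha> v \<le> tilt h \<alpha> x0" using v by (simp add: minimizers_def)
    then obtain r where r: "h v = ereal r"
      using x0 h(1) by (cases "h v") (auto simp: tilt_def proper_fun_def)
    have "conjugate_fun h \<alpha> + ereal (v \<bullet> (\<alpha>' - \<alpha>)) \<le> conjugate_fun h \<alpha>'" for \<alpha>'
      using conjugate_eq_at_minimizer[OF v r] fenchel_young[of v \<alpha>' h] r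
      by (simp add: inner_diff_right inner_commute)
    then show "v \<in> subdiff (conjugate_fun h) \<alpha>" by (simp add: subdiff_def)
  qed
qed

text \<open>One \<open>\<kappa>\<close> serves all compact sets. Any minimizer \<open>w\<close> with
  the growth bound will do, since the distance to the set is at most \<open>dist \<beta> w\<close>;
  outside the domain the tilt is infinite.\<close>

lemma firmly_convex_rel_of_growth:
  fixes h :: "'a::euclidean_space \<Rightarrow> ereal"
  assumes h: "proper_fun h" "closed_fun h" "convex_fun h" and "\<kappa> > 0"
    and attained: "v \<in> minimizers (tilt h \<nu>)"
    and growth: "\<And>\<beta>. h \<beta> < \<infinity> \<Longrightarrow> \<exists>w\<in>minimizers (tilt h \<nu>).
        tilt h \<nu> v + ereal (\<kappa> / 2 * (dist \<beta> w)\<^sup>2) \<le> tilt h \<nu> \<beta>"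
  shows "firmly_convex_rel h \<nu>"
  unfolding firmly_convex_rel_def subdiff_zeros_eq_minimizers
proof (intro conjI h allI impI exI[of _ \<kappa>] \<open>\<kappa> > 0\<close> ballI)
  fix K \<beta>
  let ?d = "set_distance \<beta> (minimizers (tilt h \<nu>))"
  show "(INF u. tilt h \<nu> u) + ereal (\<kappa> / 2) * ?d\<^sup>2 \<le> tilt h \<nu> \<beta>"
  proof (cases "h \<beta> < \<infinity>")
    case True
    obtain w where w: "w \<in> minimizers (tilt h \<nu>)"
      "tilt h \<nu> v + ereal (\<kappa> / 2 * (dist \<beta> w)\<^sup>2) \<le> tilt h \<nu> \<beta>" using growth[OF True] by blast
    have "0 \<le> ?d" unfolding set_distance_def by (rule INF_greatest) simp
    moreover have "?d \<le> ereal (dist \<beta> w)" unfolding set_distance_def using w(1) by (rule INF_lower)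
    ultimately obtain d where d: "?d = ereal d" "0 \<le> d" "d \<le> dist \<beta> w"
      by (cases ?d) auto
    have "ereal (\<kappa> / 2) * ?d\<^sup>2 = ereal (\<kappa> / 2 * d\<^sup>2)" by (simp add: d(1))
    also have "\<dots> \<le> ereal (\<kappa> / 2 * (dist \<beta> w)\<^sup>2)" using d \<open>\<kappa> > 0\<close> by (simp add: power_mono)
    finally have "(INF u. tilt h \<nu> u) + ereal (\<kappa> / 2) * ?d\<^sup>2
        \<le> tilt h \<nu> v + ereal (\<kappa> / 2 * (dist \<beta> w)\<^sup>2)"
      by (intro add_mono) (auto intro: INF_lower)
    then show ?thesis using w(2) by (rule order_trans)
  qed (simp add: tilt_def)
qed

section \<open>Gradients and growth of convex functions\<close>

lemma directional_derivative_le: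
  fixes f :: "'a::real_inner \<Rightarrow> real"
  assumes der: "GDERIV f x :> D"
    and le: "\<And>t. 0 < t \<Longrightarrow> t < 1 \<Longrightarrow> f (x + t *\<^sub>R d) - f x \<le> t * c"
  shows "D \<bullet> d \<le> c"
proof -
  have "((\<lambda>t. f (x + t *\<^sub>R d)) has_derivative (\<lambda>h. (h *\<^sub>R d) \<bullet> D)) (at 0)"
  proof (rule has_derivative_compose[of "\<lambda>t. x + t *\<^sub>R d", where f' = "\<lambda>t. t *\<^sub>R d"])
    show "((\<lambda>t. x + t *\<^sub>R d) has_derivative (\<lambda>t. t *\<^sub>R d)) (at 0)"
      by (auto intro!: derivative_eq_intros)
    show "(f has_derivative (\<lambda>h. h \<bullet> D)) (at (x + 0 *\<^sub>R d))" using der by (simp add: gderiv_def)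
  qed
  then have "((\<lambda>t. f (x + t *\<^sub>R d)) has_field_derivative (D \<bullet> d)) (at 0)"
    unfolding has_field_derivative_def
    by (rule has_derivative_eq_rhs) (simp add: fun_eq_iff inner_commute)
  then have "((\<lambda>t. (f (x + t *\<^sub>R d) - f x) / t) \<longlongrightarrow> D \<bullet> d) (at 0)"
    by (simp add: DERIV_def)
  \<comment> \<open>Only quotients with positive \<open>t\<close> are bounded by assumption; by
    differentiability their limit is still the full directional derivative.\<close>
  then have "((\<lambda>t. (f (x + t *\<^sub>R d) - f x) / t) \<longlongrightarrow> D \<bullet> d) (at_right 0)"
    by (rule filterlim_mono) (auto simp: at_within_le_at)
  moreover have "eventually (\<lambda>t. (f (x + t *\<^sub>R d) - f x) / t \<le> c) (at_right 0)"
  proof (rule eventually_mono[OF eventually_at_right_real[of 0 "1::real"]])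
    fix t :: real assume "t \<in> {0<..<1}"
    then show "(f (x + t *\<^sub>R d) - f x) / t \<le> c"
      using le[of t] by (simp add: divide_le_eq mult.commute)
  qed simp
  ultimately show ?thesis by (intro tendsto_upperbound[of _ _ "at_right (0::real)"]) auto
qed

lemma gradient_minorant:
  fixes f :: "'a::real_inner \<Rightarrow> real"
  assumes der: "GDERIV f x :> D" and conv: "convex_on UNIV f"
  shows "f x + D \<bullet> (z - x) \<le> f z"
proof -
  have "f (x + t *\<^sub>R (z - x)) - f x \<le> t * (f z - f x)" if "0 < t" "t < 1" for t
  proof -
    have "f ((1 - t) *\<^sub>R x + t *\<^sub>R z) \<le> (1 - t) * f x + t * f z"
      using convex_onD[OF conv, of t x z] that by simp
    then show ?thesis by (simp add: algebra_simps)
  qed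
  then show ?thesis using directional_derivative_le[OF der] by force
qed

text \<open>Compactness turns strict minimality into a uniform gap \<open>c\<close> on the unit
  sphere around \<open>x\<close>. Convexity propagates the gap to linear growth at rate
  \<open>c\<close>, which absorbs every perturbation of \<open>\<nu>\<close> of norm at most
  \<open>c\<close>.\<close>

lemma interior_conjugate_domain_of_strict_min:
  fixes f :: "'a::euclidean_space \<Rightarrow> real"
  assumes conv: "convex_on UNIV f" and cont: "continuous_on UNIV f"
    and min: "\<And>z. z \<noteq> x \<Longrightarrow> f x - \<nu> \<bullet> x < f z - \<nu> \<bullet> z"
  shows "\<nu> \<in> interior (effdom (conjugate_fun (\<lambda>z. ereal (f z))))"
proof -
  define \<phi> where "\<phi> z = f z - \<nu> \<bullet> z" for z
  have "continuous_on (sphere x 1) \<phi>"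
    unfolding \<phi>_def by (intro continuous_intros continuous_on_subset[OF cont]) auto
  moreover have "sphere x 1 \<noteq> {}" by simp
  ultimately obtain w where w: "w \<in> sphere x 1" "\<And>z. z \<in> sphere x 1 \<Longrightarrow> \<phi> w \<le> \<phi> z"
    using continuous_attains_inf[OF compact_sphere] by metis
  define c where "c = \<phi> w - \<phi> x"
  have "c > 0" using min[of w] w(1) by (cases "w = x") (auto simp: c_def \<phi>_def)
  have growth: "\<phi> x + c * norm (z - x) \<le> \<phi> z" if "norm (z - x) \<ge> 1" for z
  proof -
    define t where "t = inverse (norm (z - x))"
    have t: "0 < t" "t \<le> 1" using that inverse_le_1_iff by (fastforce simp: t_def)+
    have "z \<noteq> x" using that by auto
    then have t_norm: "t * norm (z - x) = 1" by (simp add: t_def)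
    \<comment> \<open>The point where the segment from \<open>x\<close> to \<open>z\<close> crosses
      the unit sphere around \<open>x\<close>.\<close>
    define q where "q = (1 - t) *\<^sub>R x + t *\<^sub>R z"
    have "q - x = t *\<^sub>R (z - x)" by (simp add: q_def algebra_simps)
    then have "norm (q - x) = 1" using t t_norm by simp
    then have "q \<in> sphere x 1" by (simp add: dist_norm norm_minus_commute)
    then have "\<phi> x + c \<le> \<phi> q" using w(2) by (simp add: c_def)
    also have "f q \<le> (1 - t) * f x + t * f z"
      using convex_onD[OF conv, of t x z] t by (simp add: q_def)
    then have "\<phi> q \<le> (1 - t) * \<phi> x + t * \<phi> z"
      by (simp add: \<phi>_def q_def inner_add_right algebra_simps)
    finally have "c \<le> t * (\<phi> z - \<phi> x)" by (simp add: algebra_simps)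
    then have "c * norm (z - x) \<le> (t * norm (z - x)) * (\<phi> z - \<phi> x)"
      by (metis mult.assoc mult.commute mult_right_mono norm_ge_zero)
    then show ?thesis by (simp add: t_norm)
  qed
  have "conjugate_fun (\<lambda>z. ereal (f z)) \<nu>' < \<infinity>" if \<nu>': "norm (\<nu>' - \<nu>) \<le> c" for \<nu>'
  proof -
    \<comment> \<open>The loss of \<open>c\<close> pays for the points within distance 1 of
      \<open>x\<close>, where minimality alone is available.\<close>
    have "\<phi> x - (\<nu>' - \<nu>) \<bullet> x - c \<le> f z - \<nu>' \<bullet> z" for z
    proof -
      have "(\<nu>' - \<nu>) \<bullet> (z - x) \<le> c * norm (z - x)"
        by (meson \<nu>' mult_right_mono norm_cauchy_schwarz norm_ge_zero order_trans)
      moreover have "\<phi> x + c * norm (z - x) - c \<le> \<phi> z"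
      proof (cases "norm (z - x) \<ge> 1")
        case True then show ?thesis using growth[of z] \<open>c > 0\<close> by simp
      next
        case False
        then have "c * norm (z - x) \<le> c" using \<open>c > 0\<close> by simp
        moreover have "\<phi> x \<le> \<phi> z" using min[of z] by (cases "z = x") (auto simp: \<phi>_def)
        ultimately show ?thesis by simp
      qed
      ultimately show ?thesis by (simp add: \<phi>_def algebra_simps)
    qed
    then have "conjugate_fun (\<lambda>z. ereal (f z)) \<nu>' \<le> ereal (- (\<phi> x - (\<nu>' - \<nu>) \<bullet> x - c))"
      unfolding conjugate_le_iff_tilt by (simp add: tilt_def)
    then show ?thesis by (metis ereal_infty_less(1) less_ereal.simps(4) not_le order_less_le_trans ereal_less_PInfty)
  qed
  then have "ball \<nu> c \<subseteq> effdom (conjugate_fun (\<lambda>z. ereal (f z)))"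
    by (auto simp: effdom_def dist_norm norm_minus_commute)
  then show ?thesis using \<open>c > 0\<close> by (meson centre_in_ball interior_maximal open_ball subsetD)
qed

text \<open>Writing a point of the polytope as a convex combination of vertices, the linear gap is at
  least a constant times the weight of the non-optimal vertices, while moving that weight to one
  optimal vertex costs at most the diameter times the weight.\<close>
lemma polytope_linear_sharpness:
  fixes P :: "'a::euclidean_space set"
  assumes "polytope P" "P \<noteq> {}"
  obtains m C where "C > 0" "\<exists>z\<in>P. l \<bullet> z = m" "\<And>z. z \<in> P \<Longrightarrow> l \<bullet> z \<le> m"
    "\<And>z. z \<in> P \<Longrightarrow> \<exists>w\<in>P. l \<bullet> w = m \<and> dist z w \<le> C * (m - l \<bullet> z)"
proof -
  obtain V where V: "finite V" "P = convex hull V" using assms(1) unfolding polytope_def by blast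
  have "V \<noteq> {}" using assms(2) V(2) by auto
  define m where "m = Max ((\<bullet>) l ` V)"
  have le_m: "l \<bullet> v \<le> m" if "v \<in> V" for v using that V(1) by (simp add: m_def)
  have "m \<in> (\<bullet>) l ` V" unfolding m_def using V(1) \<open>V \<noteq> {}\<close> by (intro Max_in) auto
  then obtain v0 where v0: "v0 \<in> V" "l \<bullet> v0 = m" by auto
  \<comment> \<open>The smallest gap of a non-optimal vertex; inserting 1 keeps the minimum
    meaningful when every vertex is optimal.\<close>
  define \<delta> where "\<delta> = Min (insert 1 ((\<lambda>v. m - l \<bullet> v) ` {v\<in>V. l \<bullet> v < m}))"
  have "\<delta> > 0" unfolding \<delta>_def using V(1) by (subst Min_gr_iff) auto
  have \<delta>: "\<delta> \<le> m - l \<bullet> v" if "v \<in> V" "l \<bullet> v < m" for v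
    unfolding \<delta>_def using that V(1) by (intro Min_le) auto
  \<comment> \<open>Bounds the distance from any vertex to \<open>v0\<close>; the summand 1 makes it
    positive even for a single vertex.\<close>
  define R where "R = 1 + (\<Sum>v\<in>V. norm (v - v0))"
  have "R > 0" unfolding R_def by (intro add_pos_nonneg sum_nonneg) auto
  have R: "norm (v - v0) \<le> R" if "v \<in> V" for v
    using member_le_sum[of v V "\<lambda>v. norm (v - v0)"] that V(1) by (simp add: R_def)
  have main: "l \<bullet> z \<le> m \<and> (\<exists>w\<in>P. l \<bullet> w = m \<and> dist z w \<le> R / \<delta> * (m - l \<bullet> z))" if "z \<in> P" for z
  proof -
    have "\<exists>u. (\<forall>v\<in>V. 0 \<le> u v) \<and> sum u V = 1 \<and> (\<Sum>v\<in>V. u v *\<^sub>R v) = z"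
      using that unfolding V(2) convex_hull_finite[OF V(1)] mem_Collect_eq .
    then obtain u where u: "\<forall>v\<in>V. 0 \<le> u v" "sum u V = 1" "(\<Sum>v\<in>V. u v *\<^sub>R v) = z"
      by blast
    \<comment> \<open>Non-optimal vertices are sent to \<open>v0\<close>, optimal ones stay in
      place; \<open>w\<close> keeps the weights of \<open>z\<close>.\<close>
    define \<pi> where "\<pi> v = (if l \<bullet> v < m then v0 else v)" for v
    define w where "w = (\<Sum>v\<in>V. u v *\<^sub>R \<pi> v)"
    have \<pi>: "\<pi> v \<in> V" "l \<bullet> \<pi> v = m" if "v \<in> V" for v
      using that v0 le_m[OF that] by (auto simp: \<pi>_def)
    have "w \<in> P"
      unfolding w_def V(2) using u(1,2) \<pi>(1) V(1)
      by (intro convex_sum convex_convex_hull) (auto intro: hull_inc)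
    have "l \<bullet> w = (\<Sum>v\<in>V. u v * m)" unfolding w_def inner_sum_right by (rule sum.cong) (auto simp: \<pi>)
    then have "l \<bullet> w = m" using u(2) by (simp flip: sum_distrib_right)
    have lz: "m - l \<bullet> z = (\<Sum>v\<in>V. u v * (m - l \<bullet> v))"
      using u(2) unfolding u(3)[symmetric] inner_sum_right
      by (simp add: right_diff_distrib sum_subtractf flip: sum_distrib_right)
    have "dist z w = norm (\<Sum>v\<in>V. u v *\<^sub>R (v - \<pi> v))"
      unfolding dist_norm w_def u(3)[symmetric] by (simp add: scaleR_diff_right sum_subtractf)
    also have "\<dots> \<le> (\<Sum>v\<in>V. R / \<delta> * (u v * (m - l \<bullet> v)))"
    proof (rule sum_norm_le)
      fix v assume v: "v \<in> V"
      show "norm (u v *\<^sub>R (v - \<pi> v)) \<le> R / \<delta> * (u v * (m - l \<bullet> v))"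
      proof (cases "l \<bullet> v < m")
        case True
        have "norm (v - v0) * \<delta> \<le> R * (m - l \<bullet> v)"
          using R[OF v] \<delta>[OF v True] \<open>\<delta> > 0\<close> \<open>R > 0\<close> by (intro mult_mono) auto
        then have "norm (v - v0) \<le> R / \<delta> * (m - l \<bullet> v)"
          using \<open>\<delta> > 0\<close> by (simp add: field_simps)
        then show ?thesis
          using mult_left_mono[OF _ bspec[OF u(1) v]] True bspec[OF u(1) v] by (fastforce simp: \<pi>_def mult_ac)
      next
        case False
        then show ?thesis using le_m[OF v] bspec[OF u(1) v] \<open>\<delta> > 0\<close> \<open>R > 0\<close> by (simp add: \<pi>_def)
      qed
    qed
    also have "\<dots> = R / \<delta> * (m - l \<bullet> z)" by (simp add: lz sum_distrib_left)
    finally have "dist z w \<le> R / \<delta> * (m - l \<bullet> z)" .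
    moreover have "0 \<le> m - l \<bullet> z" unfolding lz using u(1) le_m by (intro sum_nonneg) auto
    ultimately show ?thesis using \<open>w \<in> P\<close> \<open>l \<bullet> w = m\<close> by auto
  qed
  show ?thesis
  proof (rule that[of "R / \<delta>" m])
    show "\<exists>z\<in>P. l \<bullet> z = m" using v0 V(2) by (auto intro: hull_inc)
  qed (use main \<open>R > 0\<close> \<open>\<delta> > 0\<close> in auto)
qed

section \<open>The perspective relaxation\<close>

lemma linear_sublevel:
  fixes f :: "'a::euclidean_space \<Rightarrow> real"
  assumes "linear f"
  shows "closed {x. f x \<le> c}" "convex {x. f x \<le> c}"
proof -
  show "closed {x. f x \<le> c}"
    by (intro closed_Collect_le linear_continuous_on continuous_on_const)
      (use assms in \<open>simp add: linear_conv_bounded_linear\<close>)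
  show "convex {x. f x \<le> c}"
    using convex_linear_vimage[OF assms, of "{..c}"] by (simp add: vimage_def)
qed

locale node_relaxation =
  fixes k :: nat and M lam :: real and J0 J1 Jf :: "'p::finite set"
  assumes M_pos: "M > 0" and lam_pos: "lam > 0"
    and cover: "J0 \<union> J1 \<union> Jf = UNIV" and disjoint: "J0 \<inter> J1 = {}" "J1 \<inter> Jf = {}"
    and card_le: "card J1 \<le> k"
begin

text \<open>Independent of \<open>\<beta>\<close>. The box holds for every index because the indices
  outside \<open>Jf\<close> carry the fixed values 0 or 1.\<close>

definition Z :: "(real^'p) set" where
  "Z = {z. (\<Sum>j\<in>UNIV. z $ j) \<le> real k \<and> (\<forall>j. 0 \<le> z $ j \<and> z $ j \<le> 1) \<and>
           (\<forall>j\<in>J0. z $ j = 0) \<and> (\<forall>j\<in>J1. z $ j = 1)}"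

definition feasible :: "real^'p \<Rightarrow> (real^'p) set" where
  "feasible \<beta> = {z \<in> Z. \<forall>j. \<bar>\<beta> $ j\<bar> \<le> M * z $ j}"

text \<open>The factor \<open>lam\<close> is the weight \<open>2 * lam\<close> times the one half in
  \<open>g_node\<close>.\<close>

definition cost :: "real^'p \<Rightarrow> real^'p \<Rightarrow> real" where
  "cost \<beta> z = lam * (\<Sum>j\<in>UNIV. (\<beta> $ j)\<^sup>2 / z $ j)"

definition G :: "real^'p \<Rightarrow> ereal" where
  "G \<beta> = ereal (2 * lam) * g_node k M J0 J1 Jf \<beta>"

lemma node_domain_iff: "(\<beta>, z) \<in> node_domain k M J0 J1 Jf \<longleftrightarrow> z \<in> feasible \<beta>"
proof -
  have "0 \<le> z $ j \<and> z $ j \<le> 1"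
    if "\<forall>j\<in>J0. z $ j = 0" "\<forall>j\<in>J1. z $ j = 1" "\<forall>j\<in>Jf. 0 \<le> z $ j \<and> z $ j \<le> 1" for j
    using that cover by (cases "j \<in> J0"; cases "j \<in> J1") auto
  then show ?thesis unfolding node_domain_def feasible_def Z_def by auto
qed

lemma feasible_zero:
  assumes "z \<in> feasible \<beta>" "z $ j = 0" shows "\<beta> $ j = 0"
proof -
  have "\<bar>\<beta> $ j\<bar> \<le> M * z $ j" using assms(1) by (simp add: feasible_def)
  then show ?thesis using assms(2) by simp
qed

section \<open>The polytope of admissible z\<close>

lemma polyhedron_Z: "polyhedron Z"
proof -
  have ones: "(\<chi> j. 1) \<bullet> z = (\<Sum>j\<in>UNIV. z $ j)" for z :: "real^'p"
    by (simp add: inner_vec_def)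
  have "Z = {z. (\<chi> j. 1) \<bullet> z \<le> real k} \<inter> (\<Inter>j. {z. axis j 1 \<bullet> z \<ge> 0} \<inter> {z. axis j 1 \<bullet> z \<le> 1})
     \<inter> (\<Inter>j\<in>J0. {z. axis j 1 \<bullet> z = 0}) \<inter> (\<Inter>j\<in>J1. {z. axis j 1 \<bullet> z = 1})"
    unfolding Z_def ones by (auto simp: inner_axis')
  then show ?thesis
    by (auto intro!: polyhedron_Int polyhedron_Inter polyhedron_halfspace_le
        polyhedron_halfspace_ge polyhedron_hyperplane)
qed

lemma bounded_Z: "bounded Z"
  by (rule bounded_subset[OF bounded_cbox[of 0 1]]) (auto simp: Z_def mem_box_cart)

lemma polytope_Z: "polytope Z"
  using polyhedron_Z bounded_Z by (simp add: polytope_eq_bounded_polyhedron)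

lemma compact_Z: "compact Z"
  using polytope_Z by (rule polytope_imp_compact)

lemma Z_nonempty: "Z \<noteq> {}"
proof -
  have "(\<chi> j. if j \<in> J1 then 1 else 0) \<in> Z"
    using card_le disjoint by (auto simp: Z_def sum.If_cases)
  then show ?thesis by blast
qed

text \<open>The big-M constraint gives a square of at most
  \<open>M\<^sup>2 * (z $ j)\<^sup>2\<close>, and \<open>z $ j\<close> is at most 1. The upper
  bound, uniform over the domain, later confines the graph of \<open>G\<close> to a compact
  slab.\<close>

lemma cost_term_bounds:
  assumes "z \<in> feasible \<beta>" shows "0 \<le> (\<beta> $ j)\<^sup>2 / z $ j" "(\<beta> $ j)\<^sup>2 / z $ j \<le> M\<^sup>2"
proof -
  have z: "\<bar>\<beta> $ j\<bar> \<le> M * z $ j" "0 \<le> z $ j" "z $ j \<le> 1"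
    using assms by (auto simp: feasible_def Z_def)
  then show "0 \<le> (\<beta> $ j)\<^sup>2 / z $ j" by simp
  have "(\<beta> $ j)\<^sup>2 \<le> (M * z $ j)\<^sup>2" using z(1) by (metis abs_ge_zero power2_abs power_mono)
  also have "\<dots> = M\<^sup>2 * (z $ j * z $ j)" by (simp add: power2_eq_square)
  also have "\<dots> \<le> M\<^sup>2 * (z $ j * 1)" using z by (intro mult_left_mono) auto
  finally have "(\<beta> $ j)\<^sup>2 \<le> M\<^sup>2 * z $ j" by simp
  then show "(\<beta> $ j)\<^sup>2 / z $ j \<le> M\<^sup>2"
    using z(2) by (cases "z $ j = 0") (auto simp: divide_le_eq)
qed

lemma cost_bounds:
  assumes "z \<in> feasible \<beta>"
  shows "0 \<le> cost \<beta> z" "cost \<beta> z \<le> lam * (real CARD('p) * M\<^sup>2)"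
proof -
  show "0 \<le> cost \<beta> z"
    unfolding cost_def using lam_pos cost_term_bounds(1)[OF assms]
    by (intro mult_nonneg_nonneg sum_nonneg) auto
  have "(\<Sum>j\<in>UNIV. (\<beta> $ j)\<^sup>2 / z $ j) \<le> real CARD('p) * M\<^sup>2"
    using cost_term_bounds(2)[OF assms] by (intro sum_bounded_above) auto
  then show "cost \<beta> z \<le> lam * (real CARD('p) * M\<^sup>2)" using lam_pos by (simp add: cost_def)
qed

lemma g_node_eq: "g_node k M J0 J1 Jf \<beta> = (INF z\<in>feasible \<beta>. ereal (cost \<beta> z / (2 * lam)))"
proof -
  have "ereal (1 / 2) * (\<Sum>j\<in>UNIV. quad_over_lin (\<beta> $ j) (z $ j)) = ereal (cost \<beta> z / (2 * lam))"
    if z: "z \<in> feasible \<beta>" for z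
  proof -
    \<comment> \<open>Feasibility excludes the infinite value, and HOL's \<open>0 / 0 = 0\<close> is the paper's convention.\<close>
    have "quad_over_lin (\<beta> $ j) (z $ j) = ereal ((\<beta> $ j)\<^sup>2 / z $ j)" for j
      using feasible_zero[OF z, of j] by (simp add: quad_over_lin_def zero_ereal_def)
    then show ?thesis using lam_pos by (simp add: cost_def)
  qed
  then show ?thesis unfolding g_node_def node_domain_iff by (auto intro!: INF_cong)
qed

section \<open>Attainment of the infimum over z\<close>

lemma closed_feasible: "closed (feasible \<beta>)"
proof -
  have "feasible \<beta> = Z \<inter> {z. \<forall>j. \<bar>\<beta> $ j\<bar> \<le> M * z $ j}" by (auto simp: feasible_def)
  moreover have "closed {z. \<forall>j. \<bar>\<beta> $ j\<bar> \<le> M * (z::real^'p) $ j}"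
    by (intro closed_Collect_all closed_Collect_le continuous_intros)
  ultimately show ?thesis using compact_Z by (simp add: closed_Int compact_imp_closed)
qed

lemma compact_feasible: "compact (feasible \<beta>)"
proof -
  have "feasible \<beta> \<subseteq> Z" by (auto simp: feasible_def)
  then show ?thesis using compact_Z closed_feasible by (metis compact_Int_closed inf.absorb_iff2)
qed

lemma G_infeasible: "feasible \<beta> = {} \<Longrightarrow> G \<beta> = \<infinity>"
  using lam_pos by (simp add: G_def g_node_eq top_ereal_def)

text \<open>Each summand is continuous in \<open>z\<close> on the compact feasible set: if
  \<open>\<beta> $ j\<close> is zero it vanishes identically, otherwise feasibility keeps
  \<open>z $ j\<close> away from zero.\<close>

lemma G_attained:
  assumes "feasible \<beta> \<noteq> {}"
  obtains z where "z \<in> feasible \<beta>" "G \<beta> = ereal (cost \<beta> z)"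
    "\<And>z'. z' \<in> feasible \<beta> \<Longrightarrow> cost \<beta> z \<le> cost \<beta> z'"
proof -
  have "continuous_on (feasible \<beta>) (\<lambda>z. (\<beta> $ j)\<^sup>2 / z $ j)" for j
  proof (cases "\<beta> $ j = 0")
    case False
    then show ?thesis using feasible_zero by (intro continuous_intros) auto
  qed simp
  then have "continuous_on (feasible \<beta>) (cost \<beta>)"
    unfolding cost_def by (intro continuous_on_mult continuous_on_const continuous_on_sum)
  then obtain z where z: "z \<in> feasible \<beta>" "\<And>z'. z' \<in> feasible \<beta> \<Longrightarrow> cost \<beta> z \<le> cost \<beta> z'"
    using continuous_attains_inf[OF compact_feasible assms] by metis
  have "g_node k M J0 J1 Jf \<beta> = ereal (cost \<beta> z / (2 * lam))"
    unfolding g_node_eq using z lam_pos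
    by (intro antisym INF_lower INF_greatest) (auto intro: divide_right_mono)
  then show ?thesis using that z lam_pos by (simp add: G_def)
qed

text \<open>Attainment removes any approximation here, so the epigraph of \<open>G\<close> is
  exactly a projection.\<close>

lemma G_le_iff: "G \<beta> \<le> ereal r \<longleftrightarrow> (\<exists>z\<in>feasible \<beta>. cost \<beta> z \<le> r)"
proof (cases "feasible \<beta> = {}")
  case True then show ?thesis using G_infeasible[OF True] by simp
next
  case False
  then show ?thesis by (rule G_attained) (metis ereal_less_eq(3) order_trans)
qed

lemma effdom_G: "effdom G = {\<beta>. feasible \<beta> \<noteq> {}}"
proof -
  have "G \<beta> < \<infinity> \<longleftrightarrow> feasible \<beta> \<noteq> {}" for \<beta>
  proof (cases "feasible \<beta> = {}")
    case False
    then obtain z where "G \<beta> = ereal (cost \<beta> z)" by (rule G_attained)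
    then show ?thesis using False by simp
  qed (simp add: G_infeasible)
  then show ?thesis by (simp add: effdom_def)
qed

lemma G_bounds:
  assumes "G \<beta> < \<infinity>"
  obtains r where "G \<beta> = ereal r" "0 \<le> r" "r \<le> lam * (real CARD('p) * M\<^sup>2)"
proof -
  have "feasible \<beta> \<noteq> {}" using assms G_infeasible by force
  then show ?thesis using that cost_bounds by (metis G_attained)
qed

lemma G_nonneg: "0 \<le> G \<beta>"
proof (cases "G \<beta> < \<infinity>")
  case True
  then show ?thesis by (rule G_bounds) simp
qed simp

lemma bounded_effdom_G: "bounded (effdom G)"
proof (rule bounded_subset[OF bounded_cbox[of "\<chi> j. - M" "\<chi> j. M"]])
  have "\<bar>\<beta> $ j\<bar> \<le> M" if "z \<in> feasible \<beta>" for \<beta> z j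
  proof -
    have "\<bar>\<beta> $ j\<bar> \<le> M * z $ j" "z $ j \<le> 1" using that by (auto simp: feasible_def Z_def)
    then show ?thesis using M_pos by (smt (verit) mult_left_le)
  qed
  then have "\<bar>\<beta> $ j\<bar> \<le> M" if "\<beta> \<in> effdom G" for \<beta> j
    using that unfolding effdom_G by blast
  then show "effdom G \<subseteq> cbox (\<chi> j. - M) (\<chi> j. M)"
    by (auto simp: mem_box_cart abs_le_iff minus_le_iff)
qed

lemma zero_in_effdom: "0 \<in> effdom G"
proof -
  obtain z where "z \<in> Z" using Z_nonempty by blast
  then have "z \<in> feasible 0" using M_pos by (auto simp: feasible_def Z_def)
  then show ?thesis by (auto simp: effdom_G)
qed

lemma proper_G: "proper_fun G"
  using zero_in_effdom G_nonneg unfolding proper_fun_def effdom_def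
  by (metis (no_types, lifting) ereal_infty_less_eq(2) mem_Collect_eq MInfty_neq_ereal(1) zero_ereal_def)

text \<open>Since \<open>b\<^sup>2 / z\<close> is the supremum of \<open>2 u b - u\<^sup>2 z\<close> over \<open>u\<close>, the points \<open>(z, \<beta>, r)\<close> with
  \<open>z\<close> feasible for \<open>\<beta>\<close> and \<open>cost \<beta> z \<le> r\<close> are cut out by linear inequalities; the epigraph of
  \<open>G\<close> is the projection of this set along the compact set \<open>Z\<close>.\<close>
lemma cost_le_iff:
  assumes "z \<in> feasible \<beta>"
  shows "cost \<beta> z \<le> r \<longleftrightarrow> (\<forall>u::real^'p. lam * (\<Sum>j\<in>UNIV. 2 * u $ j * \<beta> $ j - (u $ j)\<^sup>2 * z $ j) \<le> r)"
proof (intro iffI allI)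
  fix u :: "real^'p"
  assume le: "cost \<beta> z \<le> r"
  have "2 * u $ j * \<beta> $ j - (u $ j)\<^sup>2 * z $ j \<le> (\<beta> $ j)\<^sup>2 / z $ j" for j
  proof (cases "z $ j = 0")
    case True
    then show ?thesis using feasible_zero[OF assms True] by simp
  next
    case False
    then have "z $ j > 0" using assms by (auto simp: feasible_def Z_def order_less_le)
    moreover have "0 \<le> (u $ j * z $ j - \<beta> $ j)\<^sup>2" by simp
    ultimately show ?thesis by (simp add: field_simps power2_eq_square)
  qed
  then have "lam * (\<Sum>j\<in>UNIV. 2 * u $ j * \<beta> $ j - (u $ j)\<^sup>2 * z $ j) \<le> cost \<beta> z"
    unfolding cost_def using lam_pos by (intro mult_left_mono sum_mono) auto
  then show "lam * (\<Sum>j\<in>UNIV. 2 * u $ j * \<beta> $ j - (u $ j)\<^sup>2 * z $ j) \<le> r" using le by simp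
next
  assume le: "\<forall>u::real^'p. lam * (\<Sum>j\<in>UNIV. 2 * u $ j * \<beta> $ j - (u $ j)\<^sup>2 * z $ j) \<le> r"
  have "2 * (\<beta> $ j / z $ j) * \<beta> $ j - (\<beta> $ j / z $ j)\<^sup>2 * z $ j = (\<beta> $ j)\<^sup>2 / z $ j" for j
    by (cases "z $ j = 0") (simp_all add: field_simps power2_eq_square)
  \<comment> \<open>The supremum over \<open>u\<close> is attained at these quotients; where
    \<open>z $ j = 0\<close>, both the quotient and the summand are 0.\<close>
  then show "cost \<beta> z \<le> r" using le[rule_format, of "\<chi> j. \<beta> $ j / z $ j"] by (simp add: cost_def)
qed

definition lifted_epi :: "((real^'p) \<times> (real^'p) \<times> real) set" where
  "lifted_epi = {(z, \<beta>, r). z \<in> feasible \<beta> \<and> cost \<beta> z \<le> r}"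

text \<open>Each absolute value is split into two inequalities, so that apart from \<open>Z\<close>
  every set has the form of a linear function being at most 0.\<close>

lemma lifted_epi_eq:
  "lifted_epi = fst -` Z
     \<inter> (\<Inter>j. {x. (fst (snd x) $ j - M * fst x $ j) \<le> 0} \<inter> {x. (- fst (snd x) $ j - M * fst x $ j) \<le> 0})
     \<inter> (\<Inter>u::real^'p. {x. (lam * (\<Sum>j\<in>UNIV. 2 * u $ j * fst (snd x) $ j - (u $ j)\<^sup>2 * fst x $ j)
                  - snd (snd x)) \<le> 0})"
    (is "_ = ?A \<inter> ?B \<inter> ?C")
proof -
  have "(z, \<beta>, r) \<in> lifted_epi \<longleftrightarrow> (z, \<beta>, r) \<in> ?A \<inter> ?B \<inter> ?C" for z \<beta> r
  proof -
    have "z \<in> feasible \<beta> \<longleftrightarrow> (z, \<beta>, r) \<in> ?A \<inter> ?B"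
      by (auto simp: feasible_def abs_le_iff)
    moreover have "cost \<beta> z \<le> r \<longleftrightarrow> (z, \<beta>, r) \<in> ?C" if "z \<in> feasible \<beta>"
      using cost_le_iff[OF that] by simp
    ultimately show ?thesis by (auto simp: lifted_epi_def)
  qed
  then show ?thesis by auto
qed

lemma lifted_epi: "closed lifted_epi" "convex lifted_epi"
proof -
  have lin1: "linear (\<lambda>x::(real^'p) \<times> (real^'p) \<times> real. fst (snd x) $ j - M * fst x $ j)"
   and lin2: "linear (\<lambda>x::(real^'p) \<times> (real^'p) \<times> real. - fst (snd x) $ j - M * fst x $ j)" for j
    by (auto intro!: linearI simp: algebra_simps)
  have lin3: "linear (\<lambda>x::(real^'p) \<times> (real^'p) \<times> real.
      lam * (\<Sum>j\<in>UNIV. 2 * u $ j * fst (snd x) $ j - (u $ j)\<^sup>2 * fst x $ j) - snd (snd x))" for u :: "real^'p"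
    by (rule linearI) (simp_all add: algebra_simps sum.distrib sum_subtractf sum_distrib_left)
  show "closed lifted_epi" unfolding lifted_epi_eq
    using compact_imp_closed[OF compact_Z]
    by (intro closed_Int closed_INT ballI linear_sublevel lin1 lin2 lin3 closed_vimage continuous_on_fst
        continuous_on_id)
  show "convex lifted_epi" unfolding lifted_epi_eq
    using polyhedron_imp_convex[OF polyhedron_Z]
    by (intro convex_Int convex_INT linear_sublevel lin1 lin2 lin3 convex_linear_vimage linear_fst)
qed

lemma epi_G: "epi G = snd ` lifted_epi"
  by (force simp: epi_def lifted_epi_def G_le_iff image_iff)

lemma closed_G: "closed_fun G"
proof -
  have "epi G = {y. \<exists>x. x \<in> Z \<and> (x, y) \<in> lifted_epi}"
    unfolding epi_G by (force simp: lifted_epi_def feasible_def)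
  then show ?thesis
    unfolding closed_fun_def using closed_compact_projection[OF compact_Z lifted_epi(1)] by simp
qed

lemma convex_G: "convex_fun G"
  unfolding convex_fun_def epi_G using lifted_epi(2) linear_snd by (rule convex_linear_image[rotated])

lemma convex_effdom_G: "convex (effdom G)"
proof -
  have "effdom G = fst ` epi G"
    unfolding epi_G effdom_G by (force simp: lifted_epi_def image_iff)
  then show ?thesis using convex_G convex_linear_image[OF linear_fst] by (simp add: convex_fun_def)
qed

text \<open>Finite values along a line would place the whole line in the bounded domain of
  \<open>G\<close>.\<close>

lemma no_affine_lines_G: "no_affine_lines G"
  unfolding no_affine_lines_def
proof (intro notI, elim exE conjE)
  fix x d :: "real^'p" and a b :: real
  assume d: "d \<noteq> 0" and "\<forall>t. G (x + t *\<^sub>R d) = ereal (a + b * t)"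
  then have "x + t *\<^sub>R d \<in> effdom G" for t by (simp add: effdom_def)
  then obtain B where B: "norm (x + t *\<^sub>R d) \<le> B" for t
    using bounded_effdom_G unfolding bounded_iff by blast
  have "norm (t *\<^sub>R d) \<le> B + norm x" for t
    using norm_triangle_ineq4[of "x + t *\<^sub>R d" x] B[of t] by simp
  from this[of "(B + norm x + 1) / norm d"] show False
    using d by (simp add: abs_le_iff divide_simps split: if_splits)
qed

lemma compact_epi_slab: "compact (epi G \<inter> {x. snd x \<le> c})"
proof -
  have "epi G \<inter> {x. snd x \<le> c} \<subseteq> effdom G \<times> {0..c}"
  proof clarify
    fix \<beta> r assume "(\<beta>, r) \<in> epi G" "snd (\<beta>, r) \<le> c"
    then have "G \<beta> \<le> ereal r" "r \<le> c" by (auto simp: epi_def)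
    moreover from this have "0 \<le> r" using G_nonneg[of \<beta>] by (metis ereal_less_eq(5) order_trans)
    ultimately show "\<beta> \<in> effdom G \<and> r \<in> {0..c}"
      by (auto simp: effdom_def intro: le_less_trans)
  qed
  moreover have "bounded (effdom G \<times> {0..c})" by (intro bounded_Times bounded_effdom_G) simp
  moreover have "closed (epi G \<inter> {x. snd x \<le> c})"
    using closed_G unfolding closed_fun_def
    by (intro closed_Int closed_Collect_le continuous_intros)
  ultimately show ?thesis by (simp add: compact_eq_bounded_closed bounded_subset)
qed

text \<open>Lower semicontinuity of \<open>G\<close> is used through minimising the continuous function
  \<open>(\<beta>, r) \<mapsto> \<phi> \<beta> + r\<close> over a compact piece of the epigraph.\<close>
lemma minimizers_compact_nonempty:
  fixes \<phi> :: "real^'p \<Rightarrow> real"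
  assumes cont: "continuous_on UNIV \<phi>"
  shows "compact (minimizers (\<lambda>\<beta>. ereal (\<phi> \<beta>) + G \<beta>))"
    and "minimizers (\<lambda>\<beta>. ereal (\<phi> \<beta>) + G \<beta>) \<noteq> {}"
proof -
  \<comment> \<open>By the uniform bound on finite values of \<open>G\<close>, the slab at height
    \<open>c\<close> contains the whole graph over the domain, so a minimum over the slab is
    global.\<close>
  define c where "c = lam * (real CARD('p) * M\<^sup>2)"
  have slab: "\<exists>r. G \<beta> = ereal r \<and> (\<beta>, r) \<in> epi G \<inter> {x. snd x \<le> c}" if "G \<beta> < \<infinity>" for \<beta>
    using that by (rule G_bounds) (auto simp: c_def epi_def)
  have "G 0 < \<infinity>" using zero_in_effdom by (simp add: effdom_def)
  from slab[OF this] have "epi G \<inter> {x. snd x \<le> c} \<noteq> {}" by blast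
  moreover have "continuous_on (epi G \<inter> {x. snd x \<le> c}) (\<lambda>x. \<phi> (fst x) + snd x)"
    by (intro continuous_intros continuous_on_compose2[OF cont]) auto
  ultimately have "\<exists>x\<in>epi G \<inter> {x. snd x \<le> c}.
      \<forall>x'\<in>epi G \<inter> {x. snd x \<le> c}. \<phi> (fst x) + snd x \<le> \<phi> (fst x') + snd x'"
    by (intro continuous_attains_inf compact_epi_slab)
  then obtain x where x: "x \<in> epi G \<inter> {x. snd x \<le> c}"
      "\<forall>x'\<in>epi G \<inter> {x. snd x \<le> c}. \<phi> (fst x) + snd x \<le> \<phi> (fst x') + snd x'"
    by blast
  define m where "m = \<phi> (fst x) + snd x"
  have m_le: "ereal m \<le> ereal (\<phi> \<beta>) + G \<beta>" for \<beta>
  proof (cases "G \<beta> < \<infinity>")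
    case True
    then obtain r where r: "G \<beta> = ereal r" "(\<beta>, r) \<in> epi G \<inter> {x. snd x \<le> c}" using slab by blast
    then show ?thesis using bspec[OF x(2) r(2)] by (simp add: m_def)
  qed simp
  have Gx: "ereal (\<phi> (fst x)) + G (fst x) \<le> ereal m"
    using x(1) add_left_mono[of "G (fst x)" "ereal (snd x)" "ereal (\<phi> (fst x))"]
    by (simp add: epi_def m_def)
  have eq: "minimizers (\<lambda>\<beta>. ereal (\<phi> \<beta>) + G \<beta>) = {\<beta>. ereal (\<phi> \<beta>) + G \<beta> \<le> ereal m}"
    unfolding minimizers_def using m_le Gx by (auto intro: order_trans)
  show "minimizers (\<lambda>\<beta>. ereal (\<phi> \<beta>) + G \<beta>) \<noteq> {}" using Gx eq by auto
  \<comment> \<open>The set of minimizers is a preimage of the closed epigraph under a continuous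
    map, hence closed.\<close>
  have "ereal (\<phi> \<beta>) + G \<beta> \<le> ereal m \<longleftrightarrow> (\<beta>, m - \<phi> \<beta>) \<in> epi G" for \<beta>
    using G_nonneg[of \<beta>] by (cases "G \<beta>") (auto simp: epi_def)
  then have pre: "{\<beta>. ereal (\<phi> \<beta>) + G \<beta> \<le> ereal m} = (\<lambda>\<beta>. (\<beta>, m - \<phi> \<beta>)) -` epi G" by auto
  have "closed ((\<lambda>\<beta>. (\<beta>, m - \<phi> \<beta>)) -` epi G)"
    using closed_G unfolding closed_fun_def
    by (intro closed_vimage continuous_intros cont)
  moreover have "(\<lambda>\<beta>. (\<beta>, m - \<phi> \<beta>)) -` epi G \<subseteq> effdom G"
    by (auto simp: epi_def effdom_def intro: le_less_trans)
  ultimately show "compact (minimizers (\<lambda>\<beta>. ereal (\<phi> \<beta>) + G \<beta>))"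
    unfolding eq pre using bounded_effdom_G by (meson bounded_subset compact_eq_bounded_closed)
qed

section \<open>Tilts of G: values, minimizers and growth\<close>

definition slope :: "real^'p \<Rightarrow> real^'p" where
  "slope \<alpha> = (\<chi> j. max (- M) (min M (\<alpha> $ j / (2 * lam))))"

text \<open>Coordinatewise minus the minimum of \<open>lam * u\<^sup>2 - \<alpha> $ j * u\<close>
  over \<open>[-M, M]\<close>, attained at \<open>slope \<alpha> $ j\<close>. Minimizing the tilted
  cost over \<open>\<beta>\<close> for fixed \<open>z\<close> thus gives
  \<open>- (reward \<alpha> \<bullet> z)\<close>.\<close>

definition reward :: "real^'p \<Rightarrow> real^'p" where
  "reward \<alpha> = (\<chi> j. \<alpha> $ j * slope \<alpha> $ j - lam * (slope \<alpha> $ j)\<^sup>2)"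

lemma slope_le: "\<bar>slope \<alpha> $ j\<bar> \<le> M"
  using M_pos by (simp add: slope_def)

text \<open>The variational inequality for a projection onto an interval: the derivative of the
  quadratic at \<open>slope \<alpha> $ j\<close> points into no admissible descent
  direction.\<close>

lemma slope_optimal:
  assumes "\<bar>u\<bar> \<le> M"
  shows "0 \<le> (u - slope \<alpha> $ j) * (2 * lam * slope \<alpha> $ j - \<alpha> $ j)"
proof -
  define q where "q = \<alpha> $ j / (2 * lam)"
  have \<alpha>: "\<alpha> $ j = 2 * lam * q" using lam_pos by (simp add: q_def)
  have "0 \<le> (u - slope \<alpha> $ j) * (slope \<alpha> $ j - q)"
    using assms M_pos unfolding slope_def q_def[symmetric]
    by (auto simp: max_def min_def q_def[symmetric] intro: mult_nonneg_nonneg mult_nonpos_nonpos)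
  then have "0 \<le> (2 * lam) * ((u - slope \<alpha> $ j) * (slope \<alpha> $ j - q))" using lam_pos by simp
  then show ?thesis by (simp add: \<alpha> algebra_simps)
qed

text \<open>For fixed \<open>z\<close> the tilted cost separates over coordinates, and in \<open>u = \<beta> $ j / z $ j\<close> each
  term is a strongly convex quadratic on \<open>[-M, M]\<close> with minimiser \<open>slope \<alpha> $ j\<close>.\<close>
lemma tilted_cost_growth:
  assumes z: "z \<in> feasible \<beta>"
  shows "lam * (norm (\<beta> - (\<chi> j. z $ j * slope \<alpha> $ j)))\<^sup>2 - reward \<alpha> \<bullet> z \<le> cost \<beta> z - \<alpha> \<bullet> \<beta>"
proof -
  have summand: "lam * (\<beta> $ j - z $ j * slope \<alpha> $ j)\<^sup>2 - reward \<alpha> $ j * z $ j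
      \<le> lam * ((\<beta> $ j)\<^sup>2 / z $ j) - \<alpha> $ j * \<beta> $ j" for j
  proof (cases "z $ j = 0")
    case True
    then show ?thesis using feasible_zero[OF z True] by simp
  next
    case False
    have zj: "0 < z $ j" "z $ j \<le> 1" "\<bar>\<beta> $ j\<bar> \<le> M * z $ j"
      using z False by (auto simp: feasible_def Z_def order_less_le)
    define u s where "u = \<beta> $ j / z $ j" and "s = slope \<alpha> $ j"
    have \<beta>: "\<beta> $ j = z $ j * u" using zj by (simp add: u_def)
    have "\<bar>u\<bar> \<le> M" using zj by (simp add: u_def divide_le_eq)
    then have "0 \<le> (u - s) * (2 * lam * s - \<alpha> $ j)" unfolding s_def by (rule slope_optimal)
    \<comment> \<open>The exact expansion of the quadratic around \<open>s\<close> consists of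
      \<open>lam * (u - s)\<^sup>2\<close> and the nonnegative product just obtained.\<close>
    then have 1: "lam * (u - s)\<^sup>2 - (\<alpha> $ j * s - lam * s\<^sup>2) \<le> lam * u\<^sup>2 - \<alpha> $ j * u"
      by (simp add: algebra_simps power2_eq_square)
    \<comment> \<open>Passing from \<open>u\<close> to \<open>\<beta> $ j\<close> squares the factor
      \<open>z $ j\<close>, while the perspective supplies it only once; this is harmless since it
      is at most 1.\<close>
    have "(z $ j)\<^sup>2 \<le> z $ j" using zj by (simp add: power2_eq_square mult_left_le)
    then have "lam * ((z $ j)\<^sup>2 * (u - s)\<^sup>2) \<le> lam * (z $ j * (u - s)\<^sup>2)"
      using lam_pos by (simp add: mult_right_mono)
    moreover have "(\<beta> $ j - z $ j * s)\<^sup>2 = (z $ j)\<^sup>2 * (u - s)\<^sup>2"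
      by (simp add: \<beta> power_mult_distrib flip: right_diff_distrib)
    ultimately have "lam * (\<beta> $ j - z $ j * s)\<^sup>2 - (\<alpha> $ j * s - lam * s\<^sup>2) * z $ j
        \<le> z $ j * (lam * (u - s)\<^sup>2 - (\<alpha> $ j * s - lam * s\<^sup>2))"
      by (simp add: algebra_simps)
    also have "\<dots> \<le> z $ j * (lam * u\<^sup>2 - \<alpha> $ j * u)" using 1 zj by (intro mult_left_mono) auto
    also have "\<dots> = lam * ((\<beta> $ j)\<^sup>2 / z $ j) - \<alpha> $ j * \<beta> $ j"
      using zj(1) by (simp add: \<beta> field_simps power2_eq_square)
    finally show ?thesis by (simp add: reward_def s_def)
  qed
  have "lam * (norm (\<beta> - (\<chi> j. z $ j * slope \<alpha> $ j)))\<^sup>2 - reward \<alpha> \<bullet> z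
      = (\<Sum>j\<in>UNIV. lam * (\<beta> $ j - z $ j * slope \<alpha> $ j)\<^sup>2 - reward \<alpha> $ j * z $ j)"
    unfolding power2_norm_eq_inner inner_vec_def
    by (simp add: sum_subtractf sum_distrib_left power2_eq_square)
  also have "\<dots> \<le> (\<Sum>j\<in>UNIV. lam * ((\<beta> $ j)\<^sup>2 / z $ j) - \<alpha> $ j * \<beta> $ j)"
    by (intro sum_mono summand)
  also have "\<dots> = cost \<beta> z - \<alpha> \<bullet> \<beta>"
    by (simp add: cost_def inner_vec_def sum_subtractf sum_distrib_left)
  finally show ?thesis .
qed

text \<open>The lower bound of \<open>tilted_cost_growth\<close> is attained: ratios equal to the
  slope stay admissible because the slope is clipped at \<open>M\<close>.\<close>

lemma slope_point:
  assumes "z \<in> Z"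
  shows "z \<in> feasible (\<chi> j. z $ j * slope \<alpha> $ j)"
    and "cost (\<chi> j. z $ j * slope \<alpha> $ j) z - \<alpha> \<bullet> (\<chi> j. z $ j * slope \<alpha> $ j) = - (reward \<alpha> \<bullet> z)"
proof -
  have "\<bar>z $ j * slope \<alpha> $ j\<bar> \<le> M * z $ j" for j
  proof -
    have "0 \<le> z $ j" using assms by (simp add: Z_def)
    then show ?thesis using mult_left_mono[OF slope_le[of \<alpha> j], of "z $ j"] by (simp add: abs_mult mult.commute)
  qed
  then show "z \<in> feasible (\<chi> j. z $ j * slope \<alpha> $ j)" using assms by (simp add: feasible_def)
  have "lam * ((z $ j * slope \<alpha> $ j)\<^sup>2 / z $ j) - \<alpha> $ j * (z $ j * slope \<alpha> $ j)
      = - (reward \<alpha> $ j * z $ j)" for j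
    by (cases "z $ j = 0") (simp_all add: reward_def power2_eq_square algebra_simps)
  then have "(\<Sum>j\<in>UNIV. lam * ((z $ j * slope \<alpha> $ j)\<^sup>2 / z $ j) - \<alpha> $ j * (z $ j * slope \<alpha> $ j))
      = (\<Sum>j\<in>UNIV. - (reward \<alpha> $ j * z $ j))"
    by (rule sum.cong[OF refl])
  then show "cost (\<chi> j. z $ j * slope \<alpha> $ j) z - \<alpha> \<bullet> (\<chi> j. z $ j * slope \<alpha> $ j) = - (reward \<alpha> \<bullet> z)"
    by (simp add: cost_def inner_vec_def sum_subtractf sum_distrib_left sum_negf)
qed

lemma tilt_G_at_slope_point_le:
  assumes "z \<in> Z"
  shows "tilt G \<alpha> (\<chi> j. z $ j * slope \<alpha> $ j) \<le> ereal (- (reward \<alpha> \<bullet> z))"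
proof -
  let ?b = "\<chi> j. z $ j * slope \<alpha> $ j"
  have "G ?b \<le> ereal (cost ?b z)" using slope_point(1)[OF assms] by (auto simp: G_le_iff)
  then have "tilt G \<alpha> ?b \<le> ereal (cost ?b z) - ereal (\<alpha> \<bullet> ?b)"
    unfolding tilt_def by (rule ereal_minus_mono) simp
  then show ?thesis using slope_point(2)[OF assms, of \<alpha>] by simp
qed

lemma tilt_G_lower:
  assumes m: "\<And>z. z \<in> Z \<Longrightarrow> reward \<alpha> \<bullet> z \<le> m"
  shows "ereal (- m) \<le> tilt G \<alpha> \<beta>"
proof (cases "feasible \<beta> = {}")
  case True
  then show ?thesis using G_infeasible[OF True] by (simp add: tilt_def)
next
  case False
  then obtain z where z: "z \<in> feasible \<beta>" "G \<beta> = ereal (cost \<beta> z)" by (rule G_attained)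
  have "0 \<le> lam * (norm (\<beta> - (\<chi> j. z $ j * slope \<alpha> $ j)))\<^sup>2" using lam_pos by simp
  moreover have "reward \<alpha> \<bullet> z \<le> m" using z(1) m by (simp add: feasible_def)
  ultimately show ?thesis using tilted_cost_growth[OF z(1), of \<alpha>] by (simp add: tilt_def z(2))
qed

text \<open>The minimum is \<open>- m\<close>. At a minimizer the squared distance to the slope
  point and the gap in the linear reward are nonnegative with sum at most 0, so both vanish.\<close>

lemma minimizers_tilt_G:
  assumes m: "\<And>z. z \<in> Z \<Longrightarrow> reward \<alpha> \<bullet> z \<le> m" "z0 \<in> Z" "reward \<alpha> \<bullet> z0 = m"
  shows "minimizers (tilt G \<alpha>) = (\<lambda>z. \<chi> j. z $ j * slope \<alpha> $ j) ` (Z \<inter> {z. reward \<alpha> \<bullet> z = m})"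
proof (intro equalityI subsetI)
  fix \<beta> assume "\<beta> \<in> minimizers (tilt G \<alpha>)"
  then have "tilt G \<alpha> \<beta> \<le> ereal (- m)"
    using tilt_G_at_slope_point_le[OF m(2), of \<alpha>] m(3) unfolding minimizers_def
    by (auto intro: order_trans)
  moreover from this have ne: "feasible \<beta> \<noteq> {}" using G_infeasible[of \<beta>] by (auto simp: tilt_def)
  from G_attained[OF ne] obtain z where z: "z \<in> feasible \<beta>" "G \<beta> = ereal (cost \<beta> z)" by blast
  ultimately have "cost \<beta> z - \<alpha> \<bullet> \<beta> \<le> - m" by (simp add: tilt_def)
  then have le: "lam * (norm (\<beta> - (\<chi> j. z $ j * slope \<alpha> $ j)))\<^sup>2 + (m - reward \<alpha> \<bullet> z) \<le> 0"
    using tilted_cost_growth[OF z(1), of \<alpha>] by simp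
  have "z \<in> Z" using z(1) by (simp add: feasible_def)
  with m(1) have "0 \<le> m - reward \<alpha> \<bullet> z" by simp
  moreover have "0 \<le> lam * (norm (\<beta> - (\<chi> j. z $ j * slope \<alpha> $ j)))\<^sup>2" using lam_pos by simp
  ultimately have "reward \<alpha> \<bullet> z = m" "lam * (norm (\<beta> - (\<chi> j. z $ j * slope \<alpha> $ j)))\<^sup>2 = 0"
    using le by linarith+
  then show "\<beta> \<in> (\<lambda>z. \<chi> j. z $ j * slope \<alpha> $ j) ` (Z \<inter> {z. reward \<alpha> \<bullet> z = m})"
    using \<open>z \<in> Z\<close> lam_pos by auto
next
  fix \<beta> assume "\<beta> \<in> (\<lambda>z. \<chi> j. z $ j * slope \<alpha> $ j) ` (Z \<inter> {z. reward \<alpha> \<bullet> z = m})"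
  then have "tilt G \<alpha> \<beta> \<le> ereal (- m)" using tilt_G_at_slope_point_le by auto
  then show "\<beta> \<in> minimizers (tilt G \<alpha>)"
    unfolding minimizers_def using tilt_G_lower[OF m(1)] by (auto intro: order_trans)
qed

lemma reward_sharpness:
  obtains m C z0 where "C > 0" "z0 \<in> Z" "reward \<alpha> \<bullet> z0 = m" "\<And>z. z \<in> Z \<Longrightarrow> reward \<alpha> \<bullet> z \<le> m"
    "\<And>z. z \<in> Z \<Longrightarrow> \<exists>w\<in>Z. reward \<alpha> \<bullet> w = m \<and> dist z w \<le> C * (m - reward \<alpha> \<bullet> z)"
  using polytope_linear_sharpness[OF polytope_Z Z_nonempty, of "reward \<alpha>"] by metis

text \<open>The reward is bounded on \<open>Z\<close>, so the conjugate is finite everywhere and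
  interiority for it is automatic.\<close>

lemma conjugate_G_finite: "conjugate_fun G \<alpha> < \<infinity>"
proof -
  obtain m C z0 where "\<And>z. z \<in> Z \<Longrightarrow> reward \<alpha> \<bullet> z \<le> m" using reward_sharpness[of \<alpha>] by metis
  then have "conjugate_fun G \<alpha> \<le> ereal m" using tilt_G_lower by (simp add: conjugate_le_iff_tilt)
  then show ?thesis by (rule le_less_trans) simp
qed

lemma polyhedron_minimizers_tilt_G: "polyhedron (minimizers (tilt G \<alpha>))"
proof -
  obtain m C z0 where m: "\<And>z. z \<in> Z \<Longrightarrow> reward \<alpha> \<bullet> z \<le> m" "z0 \<in> Z" "reward \<alpha> \<bullet> z0 = m"
    using reward_sharpness[of \<alpha>] by metis
  have "polytope (Z \<inter> {z. reward \<alpha> \<bullet> z = m})"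
    by (simp add: polytope_eq_bounded_polyhedron bounded_Int bounded_Z polyhedron_Z
        polyhedron_hyperplane)
  moreover have "linear (\<lambda>z::real^'p. \<chi> j. z $ j * slope \<alpha> $ j)"
    by (rule linearI) (simp_all add: vec_eq_iff algebra_simps)
  ultimately have "polytope (minimizers (tilt G \<alpha>))"
    by (subst minimizers_tilt_G[OF m]) (auto intro: polytope_linear_image)
  then show ?thesis by (rule polytope_imp_polyhedron)
qed

text \<open>Two errors add up: from \<open>\<beta>\<close> to the slope point of its optimal
  \<open>z\<close>, by strong convexity, and from that \<open>z\<close> to the optimal face, by
  linear sharpness. Both squared errors are at most a constant times the gap.\<close>

lemma firmly_convex_rel_G: "firmly_convex_rel G \<alpha>"
proof -
  obtain m C z0 where C: "C > 0" and m: "\<And>z. z \<in> Z \<Longrightarrow> reward \<alpha> \<bullet> z \<le> m" "z0 \<in> Z" "reward \<alpha> \<bullet> z0 = m"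
    and sharp: "\<And>z. z \<in> Z \<Longrightarrow> \<exists>w\<in>Z. reward \<alpha> \<bullet> w = m \<and> dist z w \<le> C * (m - reward \<alpha> \<bullet> z)"
    using reward_sharpness[of \<alpha>] by metis
  let ?S = "\<lambda>z. \<chi> j. z $ j * slope \<alpha> $ j"
  have min_eq: "minimizers (tilt G \<alpha>) = ?S ` (Z \<inter> {z. reward \<alpha> \<bullet> z = m})"
    by (rule minimizers_tilt_G[OF m])
  obtain R where R: "R > 0" "\<And>z. z \<in> Z \<Longrightarrow> norm z \<le> R" using bounded_Z bounded_pos by blast
  \<comment> \<open>The two terms come from doubling \<open>1 / lam\<close> and
    \<open>M\<^sup>2 * (2 * R) * C\<close>, the doubling being due to
    \<open>(a + b)\<^sup>2 \<le> 2 * a\<^sup>2 + 2 * b\<^sup>2\<close>.\<close>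
  define A where "A = 2 / lam + 4 * M\<^sup>2 * R * C"
  have "A > 0" unfolding A_def using lam_pos M_pos R(1) C by (intro add_pos_nonneg) auto
  have S_dist: "norm (?S z - ?S w) \<le> M * norm (z - w)" for z w
  proof -
    have "norm (?S z - ?S w) \<le> norm (M *\<^sub>R (z - w))"
    proof (rule norm_le_componentwise_cart)
      fix j
      have "(?S z - ?S w) $ j = (z $ j - w $ j) * slope \<alpha> $ j" by (simp add: algebra_simps)
      moreover have "\<bar>z $ j - w $ j\<bar> * \<bar>slope \<alpha> $ j\<bar> \<le> \<bar>z $ j - w $ j\<bar> * M"
        by (intro mult_left_mono slope_le) simp
      ultimately show "norm ((?S z - ?S w) $ j) \<le> norm ((M *\<^sub>R (z - w)) $ j)"
        using M_pos by (simp add: abs_mult mult.commute)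
    qed
    then show ?thesis using M_pos by simp
  qed
  have min_val: "tilt G \<alpha> (?S z0) = ereal (- m)"
    using tilt_G_at_slope_point_le[OF m(2), of \<alpha>] tilt_G_lower[OF m(1)] m(3) by (simp add: antisym)
  show ?thesis
  proof (rule firmly_convex_rel_of_growth[OF proper_G closed_G convex_G, where v = "?S z0" and \<kappa> = "2 / A"])
    show "?S z0 \<in> minimizers (tilt G \<alpha>)" using m by (auto simp: min_eq)
  next
    fix \<beta> assume "G \<beta> < \<infinity>"
    then have "feasible \<beta> \<noteq> {}" using G_infeasible[of \<beta>] by auto
    from G_attained[OF this] obtain z where z: "z \<in> feasible \<beta>" "G \<beta> = ereal (cost \<beta> z)" by blast
    have "z \<in> Z" using z(1) by (simp add: feasible_def)
    then obtain w where w: "w \<in> Z" "reward \<alpha> \<bullet> w = m" "dist z w \<le> C * (m - reward \<alpha> \<bullet> z)"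
      using sharp by blast
    define gap where "gap = cost \<beta> z - \<alpha> \<bullet> \<beta> + m"
    have lz: "0 \<le> m - reward \<alpha> \<bullet> z" using m(1) \<open>z \<in> Z\<close> by simp
    have g: "lam * (norm (\<beta> - ?S z))\<^sup>2 + (m - reward \<alpha> \<bullet> z) \<le> gap"
      using tilted_cost_growth[OF z(1), of \<alpha>] by (simp add: gap_def)
    have d1: "(norm (\<beta> - ?S z))\<^sup>2 \<le> gap / lam" using g lz lam_pos by (simp add: pos_le_divide_eq mult.commute)
    have "0 \<le> lam * (norm (\<beta> - ?S z))\<^sup>2" using lam_pos by simp
    then have "m - reward \<alpha> \<bullet> z \<le> gap" using g by linarith
    then have zw: "norm (z - w) \<le> C * gap"
      using w(3) C by (simp add: dist_norm) (meson mult_left_mono less_imp_le order_trans)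
    \<comment> \<open>In the square one factor is bounded by the diameter and the other by
      sharpness, so the square is linear in the gap.\<close>
    have "norm (z - w) \<le> 2 * R" using norm_triangle_ineq4[of z w] R(2)[OF \<open>z \<in> Z\<close>] R(2)[OF w(1)] by simp
    then have "(norm (z - w))\<^sup>2 \<le> (2 * R) * (C * gap)"
      unfolding power2_eq_square using zw R(1) by (intro mult_mono) auto
    then have "M\<^sup>2 * (norm (z - w))\<^sup>2 \<le> M\<^sup>2 * ((2 * R) * (C * gap))" by (intro mult_left_mono) auto
    moreover have "(norm (?S z - ?S w))\<^sup>2 \<le> M\<^sup>2 * (norm (z - w))\<^sup>2"
      using power_mono[OF S_dist[of z w], of 2] by (simp add: power_mult_distrib)
    ultimately have d2: "(norm (?S z - ?S w))\<^sup>2 \<le> M\<^sup>2 * ((2 * R) * (C * gap))" by linarith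
    have "(norm (\<beta> - ?S w))\<^sup>2 \<le> (norm (\<beta> - ?S z) + norm (?S z - ?S w))\<^sup>2"
      using norm_triangle_ineq[of "\<beta> - ?S z" "?S z - ?S w"] by (intro power_mono) auto
    also have "\<dots> \<le> 2 * (norm (\<beta> - ?S z))\<^sup>2 + 2 * (norm (?S z - ?S w))\<^sup>2"
      using zero_le_power2[of "norm (\<beta> - ?S z) - norm (?S z - ?S w)"]
      by (simp add: power2_sum power2_diff)
    also have "\<dots> \<le> 2 * (gap / lam) + 2 * (M\<^sup>2 * ((2 * R) * (C * gap)))" using d1 d2 by simp
    also have "\<dots> = A * gap" by (simp add: A_def algebra_simps)
    finally have "(dist \<beta> (?S w))\<^sup>2 / A \<le> gap" using \<open>A > 0\<close> by (simp add: dist_norm divide_le_eq mult.commute)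
    then have "tilt G \<alpha> (?S z0) + ereal (2 / A / 2 * (dist \<beta> (?S w))\<^sup>2) \<le> tilt G \<alpha> \<beta>"
      unfolding min_val by (simp add: tilt_def z(2) gap_def)
    then show "\<exists>w\<in>minimizers (tilt G \<alpha>).
        tilt G \<alpha> (?S z0) + ereal (2 / A / 2 * (dist \<beta> w)\<^sup>2) \<le> tilt G \<alpha> \<beta>"
      using w(1,2) unfolding min_eq by blast
  qed (use \<open>A > 0\<close> in simp)
qed

end

section \<open>Smooth convex functions and duality\<close>

text \<open>On an affine line the midpoint inequality is an equality.\<close>

lemma no_affine_lines_of_strictly_convex:
  assumes "strictly_convex_fun h" shows "no_affine_lines h"
  unfolding no_affine_lines_def
proof (intro notI, elim exE conjE)
  fix x d :: 'a and a b :: real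
  assume d: "d \<noteq> 0" and line: "\<forall>t. h (x + t *\<^sub>R d) = ereal (a + b * t)"
  have vals: "h x = ereal a" "h (x + d) = ereal (a + b)"
    using line[rule_format, of 0] line[rule_format, of 1] by simp_all
  have "h ((1 - 1/2) *\<^sub>R x + (1/2) *\<^sub>R (x + d)) < ereal (1 - 1/2) * h x + ereal (1/2) * h (x + d)"
    by (rule assms[unfolded strictly_convex_fun_def, rule_format]) (use d vals in \<open>auto simp: effdom_def\<close>)
  moreover have "(1 - 1/2) *\<^sub>R x + (1/2) *\<^sub>R (x + d) = x + (1/2) *\<^sub>R d"
    by (simp add: scaleR_add_right flip: scaleR_add_left)
  ultimately show False using line[rule_format, of "1/2"] vals by (simp add: field_simps)
qed

lemma strictly_convex_real_iff:
  "strictly_convex_fun (\<lambda>z. ereal (\<phi> z)) \<longleftrightarrow>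
    (\<forall>x y t. x \<noteq> y \<longrightarrow> 0 < t \<longrightarrow> t < 1 \<longrightarrow> \<phi> ((1 - t) *\<^sub>R x + t *\<^sub>R y) < (1 - t) * \<phi> x + t * \<phi> y)"
  by (simp add: strictly_convex_fun_def effdom_def)

lemma convex_on_of_strictly_convex:
  assumes "strictly_convex_fun (\<lambda>z. ereal (\<phi> z))" shows "convex_on UNIV \<phi>"
proof (rule convex_onI)
  fix t :: real and x y assume t: "0 < t" "t < 1"
  show "\<phi> ((1 - t) *\<^sub>R x + t *\<^sub>R y) \<le> (1 - t) * \<phi> x + t * \<phi> y"
  proof (cases "x = y")
    case True
    then show ?thesis by (simp add: algebra_simps flip: scaleR_add_left)
  next
    case False
    then show ?thesis using assms t unfolding strictly_convex_real_iff by (simp add: less_imp_le)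
  qed
qed simp

text \<open>The tangent inequality is applied at the midpoint of \<open>x\<close> and
  \<open>z\<close>, where strict convexity makes the chord strictly larger.\<close>

lemma gradient_minorant_strict:
  fixes \<phi> :: "'a::real_inner \<Rightarrow> real"
  assumes sc: "strictly_convex_fun (\<lambda>z. ereal (\<phi> z))" and der: "GDERIV \<phi> x :> D" and "z \<noteq> x"
  shows "\<phi> x - D \<bullet> x < \<phi> z - D \<bullet> z"
proof -
  let ?q = "(1 - 1/2) *\<^sub>R x + (1/2::real) *\<^sub>R z"
  have "\<phi> x + D \<bullet> (?q - x) \<le> \<phi> ?q"
    by (rule gradient_minorant[OF der convex_on_of_strictly_convex[OF sc]])
  also have "\<phi> ?q < (1 - 1/2) * \<phi> x + 1/2 * \<phi> z"
    using sc[unfolded strictly_convex_real_iff, rule_format, of x z "1/2"] \<open>z \<noteq> x\<close> by simp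
  finally show ?thesis by (simp add: inner_diff_right inner_add_right)
qed

section \<open>First-order optimality and Fenchel duality\<close>

lemma convex_fun_segment_le:
  assumes "convex_fun h" "h x = ereal a" "h y = ereal b" "0 \<le> t" "t \<le> 1"
  shows "h ((1 - t) *\<^sub>R x + t *\<^sub>R y) \<le> ereal ((1 - t) * a + t * b)"
proof -
  have "(x, a) \<in> epi h" "(y, b) \<in> epi h" using assms by (auto simp: epi_def)
  then have "(1 - t) *\<^sub>R (x, a) + t *\<^sub>R (y, b) \<in> epi h"
    using assms unfolding convex_fun_def convex_def by (metis diff_ge_0_iff_ge diff_add_cancel)
  then show ?thesis by (simp add: epi_def)
qed

text \<open>Along a segment convexity bounds the increase of \<open>h\<close> by
  \<open>t * (b - a)\<close>, so minimality bounds the decrease of \<open>\<phi>\<close> by the same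
  amount; the derivative of \<open>- \<phi>\<close> then gives the inequality.\<close>

lemma minimizer_of_sum_minimizes_tilt:
  fixes \<phi> :: "'a::real_inner \<Rightarrow> real"
  assumes h: "convex_fun h" "proper_fun h" and der: "GDERIV \<phi> x :> D"
    and min: "x \<in> minimizers (\<lambda>\<beta>. ereal (\<phi> \<beta>) + h \<beta>)" and hx: "h x = ereal a"
  shows "x \<in> minimizers (tilt h (- D))"
proof -
  have "tilt h (- D) x \<le> tilt h (- D) \<beta>" for \<beta>
  proof (cases "h \<beta>")
    case (real b)
    have "- \<phi> (x + t *\<^sub>R (\<beta> - x)) - - \<phi> x \<le> t * (b - a)" if "0 < t" "t < 1" for t
    proof -
      let ?q = "x + t *\<^sub>R (\<beta> - x)"
      have q: "?q = (1 - t) *\<^sub>R x + t *\<^sub>R \<beta>" by (simp add: algebra_simps)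
      have "ereal (\<phi> x) + ereal a \<le> ereal (\<phi> ?q) + h ?q"
        using min hx by (auto simp: minimizers_def)
      also have "\<dots> \<le> ereal (\<phi> ?q) + ereal ((1 - t) * a + t * b)"
        using convex_fun_segment_le[OF h(1) hx real, of t] that unfolding q by (intro add_left_mono) auto
      finally show ?thesis by (simp add: algebra_simps)
    qed
    then have "- D \<bullet> (\<beta> - x) \<le> b - a"
      by (rule directional_derivative_le[OF GDERIV_minus[OF der]])
    then show ?thesis by (simp add: tilt_def hx real inner_diff_right)
  qed (use h(2) in \<open>auto simp: tilt_def proper_fun_def\<close>)
  then show ?thesis by (simp add: minimizers_def)
qed

lemma GDERIV_matrix_compose:
  fixes X :: "real^'p^'n"
  assumes "GDERIV \<phi> (X *v \<beta>) :> D"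
  shows "GDERIV (\<lambda>\<beta>. \<phi> (X *v \<beta>)) \<beta> :> transpose X *v D"
proof -
  have "((\<lambda>\<beta>. X *v \<beta>) has_derivative (\<lambda>h. X *v h)) (at \<beta>)"
    by (rule bounded_linear_imp_has_derivative) simp
  moreover have "(\<phi> has_derivative (\<lambda>h. h \<bullet> D)) (at (X *v \<beta>))" using assms by (simp add: gderiv_def)
  ultimately have "((\<lambda>\<beta>. \<phi> (X *v \<beta>)) has_derivative (\<lambda>h. (X *v h) \<bullet> D)) (at \<beta>)"
    by (rule has_derivative_compose)
  moreover have "(X *v h) \<bullet> D = h \<bullet> (transpose X *v D)" for h
    by (simp add: dot_lmul_matrix[symmetric] inner_commute)
  ultimately show ?thesis by (simp add: gderiv_def)
qed

lemma weak_duality: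
  assumes "proper_fun F" "proper_fun G"
  shows "dual_obj F G X \<zeta> \<le> primal_obj F G X \<beta>"
proof -
  have F: "ereal (- (\<zeta> \<bullet> (X *v \<beta>))) - F (X *v \<beta>) \<le> conjugate_fun F (- \<zeta>)"
    using fenchel_young[of "X *v \<beta>" "- \<zeta>" F] by (simp add: inner_commute)
  have G: "ereal (\<zeta> \<bullet> (X *v \<beta>)) - G \<beta> \<le> conjugate_fun G (transpose X *v \<zeta>)"
    using fenchel_young[of \<beta> "transpose X *v \<zeta>" G] by (simp add: inner_commute[of \<beta>] dot_lmul_matrix)
  have "F (X *v \<beta>) \<noteq> -\<infinity>" "G \<beta> \<noteq> -\<infinity>" using assms by (simp_all add: proper_fun_def)
  then show ?thesis
    using F G unfolding dual_obj_def primal_obj_def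
    by (cases "F (X *v \<beta>)"; cases "G \<beta>"; cases "conjugate_fun F (- \<zeta>)";
        cases "conjugate_fun G (transpose X *v \<zeta>)") auto
qed

text \<open>A dual solution turns both Fenchel--Young inequalities into equalities, so its negative is
  a subgradient of the smooth function \<open>F\<close>, that is, the gradient.\<close>
lemma dual_optimal_eq_neg_gradient:
  fixes X :: "real^'p^'n"
  assumes conv: "convex_on UNIV \<phi>" and der: "GDERIV \<phi> (X *v \<beta>) :> D"
    and G: "G \<beta> = ereal r" and opt: "primal_obj (\<lambda>z. ereal (\<phi> z)) G X \<beta> \<le> dual_obj (\<lambda>z. ereal (\<phi> z)) G X \<zeta>"
  shows "\<zeta> = - D"
proof -
  let ?F = "\<lambda>z. ereal (\<phi> z)"
  have "ereal (\<zeta> \<bullet> (X *v \<beta>) - r) \<le> conjugate_fun G (transpose X *v \<zeta>)"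
    using fenchel_young[of \<beta> "transpose X *v \<zeta>" G] G by (simp add: inner_commute[of \<beta>] dot_lmul_matrix)
  then have "conjugate_fun ?F (- \<zeta>) \<le> ereal (- (\<zeta> \<bullet> (X *v \<beta>)) - \<phi> (X *v \<beta>))"
    using opt G unfolding dual_obj_def primal_obj_def
    by (cases "conjugate_fun ?F (- \<zeta>)"; cases "conjugate_fun G (transpose X *v \<zeta>)") auto
  then have sub: "\<phi> (X *v \<beta>) + - \<zeta> \<bullet> (z - X *v \<beta>) \<le> \<phi> z" for z
    unfolding conjugate_le_iff_tilt by (simp add: tilt_def inner_diff_right algebra_simps)
  have "- D \<bullet> d \<le> \<zeta> \<bullet> d" for d
  proof (rule directional_derivative_le[OF GDERIV_minus[OF der]])
    fix t :: real
    show "- \<phi> (X *v \<beta> + t *\<^sub>R d) - - \<phi> (X *v \<beta>) \<le> t * (\<zeta> \<bullet> d)"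
      using sub[of "X *v \<beta> + t *\<^sub>R d"] by simp
  qed
  \<comment> \<open>This direction turns the inequality into a bound on the squared norm of
    \<open>\<zeta> + D\<close>.\<close>
  from this[of "- \<zeta> - D"] have "(\<zeta> + D) \<bullet> (\<zeta> + D) \<le> 0"
    by (simp add: inner_diff_right inner_add_left inner_add_right inner_commute)
  then have "\<zeta> + D = 0" by (metis inner_eq_zero_iff inner_ge_zero order_antisym)
  then show ?thesis by (simp add: eq_neg_iff_add_eq_0)
qed

lemma gradient_at_of_locally_smooth:
  fixes \<phi> :: "'a::euclidean_space \<Rightarrow> real"
  assumes "locally_smooth (\<lambda>z. ereal (\<phi> z))"
  obtains g where "\<And>x. GDERIV \<phi> x :> g x"
  using assms unfolding locally_smooth_def effdom_def by auto

theorem proposition4p6: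
  fixes X :: "real^'p^'n" and y :: "real^'n"
    and lambda2 M :: real and k :: nat
    and J0 J1 Jf :: "'p set"
    and f :: "(real^'n) \<times> (real^'n) \<Rightarrow> real"
    and F :: "real^'n \<Rightarrow> ereal" and G \<Phi> :: "real^'p \<Rightarrow> ereal" and \<Psi> :: "real^'n \<Rightarrow> ereal"
  defines "F \<equiv> \<lambda>z. ereal (f (z, y))"
    and "G \<equiv> \<lambda>\<beta>. ereal (2 * lambda2) * g_node k M J0 J1 Jf \<beta>"
    and "\<Phi> \<equiv> primal_obj F G X"
    and "\<Psi> \<equiv> dual_obj F G X"
  assumes "X \<noteq> 0" and "lambda2 > 0" and "M > 0"
    and "J0 \<union> J1 \<union> Jf = UNIV" and "J0 \<inter> J1 = {}" and "J0 \<inter> Jf = {}" and "J1 \<inter> Jf = {}"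
    and "card J1 \<le> k"
    and "strictly_convex_fun F" and "locally_smooth F" and "firmly_convex F"
  shows
    "(convex_fun F \<and> locally_smooth F \<and>
        proper_fun G \<and> closed_fun G \<and> convex_fun G \<and>
        no_affine_lines F \<and> no_affine_lines G) \<and>
     (rel_interior (effdom \<Phi>) \<noteq> {} \<and> interior {\<zeta>. \<Psi> \<zeta> > -\<infinity>} \<noteq> {} \<and>
        (\<exists>\<beta>s \<zeta>s. \<beta>s \<in> rel_interior (effdom G) \<and>
           X *v \<beta>s \<in> interior (effdom F) \<and>
           - \<zeta>s \<in> interior (effdom (conjugate_fun F)) \<and>
           transpose X *v \<zeta>s \<in> interior (effdom (conjugate_fun G)))) \<and>
     (\<exists>\<zeta>star. maximizers \<Psi> = {\<zeta>star} \<and>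
        (compact (minimizers \<Phi>) \<and> (\<lambda>\<beta>. X *v \<beta>) ` minimizers \<Phi> \<subseteq> interior (effdom F)) \<and>
        (firmly_convex_rel F (- \<zeta>star) \<and> firmly_convex_rel G (transpose X *v \<zeta>star)) \<and>
        (polyhedron (subdiff (conjugate_fun F) (- \<zeta>star)) \<and>
         polyhedron (subdiff (conjugate_fun G) (transpose X *v \<zeta>star))) \<and>
        (- \<zeta>star \<in> interior (effdom (conjugate_fun F)) \<and>
         transpose X *v \<zeta>star \<in> interior (effdom (conjugate_fun G)))) \<and>
     strictly_convex_fun F"
proof -
  interpret N: node_relaxation k M lambda2 J0 J1 Jf
    using assms by unfold_locales auto
  have GN: "G = N.G" by (simp add: fun_eq_iff G_def N.G_def)
  define \<phi> where "\<phi> z = f (z, y)" for z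
  have F: "F = (\<lambda>z. ereal (\<phi> z))" by (simp add: F_def \<phi>_def)
  have sc: "strictly_convex_fun (\<lambda>z. ereal (\<phi> z))" using assms(13) by (simp add: F)
  have conv: "convex_on UNIV \<phi>" by (rule convex_on_of_strictly_convex[OF sc])
  have Fprops: "proper_fun F" "closed_fun F" "convex_fun F"
    using \<open>firmly_convex F\<close> by (simp_all add: firmly_convex_def)
  have Gprops: "proper_fun G" "closed_fun G" "convex_fun G"
    unfolding GN by (rule N.proper_G N.closed_G N.convex_G)+
  obtain g where g: "\<And>x. GDERIV \<phi> x :> g x"
    using gradient_at_of_locally_smooth[of \<phi>] \<open>locally_smooth F\<close> unfolding F by metis
  have cont: "continuous_on UNIV \<phi>"
    using g by (auto intro!: has_derivative_continuous_on simp: gderiv_def)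
  have contX: "continuous_on UNIV (\<lambda>\<beta>. \<phi> (X *v \<beta>))"
    by (intro continuous_on_compose2[OF cont] matrix_vector_mult_linear_continuous_on) auto
  have \<Phi>: "\<Phi> = (\<lambda>\<beta>. ereal (\<phi> (X *v \<beta>)) + G \<beta>)"
    by (simp add: \<Phi>_def fun_eq_iff primal_obj_def F)
  have compact_min: "compact (minimizers \<Phi>)" and "minimizers \<Phi> \<noteq> {}"
    unfolding \<Phi> GN by (rule N.minimizers_compact_nonempty[OF contX])+
  then obtain \<beta> where \<beta>: "\<beta> \<in> minimizers \<Phi>" by blast
  have "\<Phi> \<beta> \<le> \<Phi> 0" using \<beta> by (simp add: minimizers_def)
  moreover have "\<Phi> 0 < \<infinity>" using N.zero_in_effdom by (simp add: \<Phi> GN effdom_def)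
  ultimately have "G \<beta> < \<infinity>" by (auto simp: \<Phi>)
  then obtain r where r: "G \<beta> = ereal r" unfolding GN using N.G_bounds by metis
  \<comment> \<open>The dual candidate. Strict convexity makes \<open>z\<close> the unique minimizer
    of the tilt of \<open>F\<close> by \<open>- \<zeta>\<close>.\<close>
  define z \<zeta> where "z = X *v \<beta>" and "\<zeta> = - g z"

  have F_min: "\<phi> z - (- \<zeta>) \<bullet> z < \<phi> w - (- \<zeta>) \<bullet> w" if "w \<noteq> z" for w
    using gradient_minorant_strict[OF sc g that] by (simp add: \<zeta>_def)
  then have F_min_le: "\<phi> z - (- \<zeta>) \<bullet> z \<le> \<phi> w - (- \<zeta>) \<bullet> w" for w
    by (cases "w = z") (auto intro: less_imp_le)
  have F_minimizers: "minimizers (tilt F (- \<zeta>)) = {z}"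
  proof (intro equalityI subsetI)
    fix w assume "w \<in> minimizers (tilt F (- \<zeta>))"
    then have "\<phi> w - (- \<zeta>) \<bullet> w \<le> \<phi> z - (- \<zeta>) \<bullet> z" by (simp add: minimizers_def tilt_def F)
    then show "w \<in> {z}" using F_min[of w] by force
  next
    fix w assume "w \<in> {z}"
    then show "w \<in> minimizers (tilt F (- \<zeta>))"
      using F_min_le by (simp add: minimizers_def tilt_def F)
  qed
  have intF: "- \<zeta> \<in> interior (effdom (conjugate_fun F))"
    unfolding F by (rule interior_conjugate_domain_of_strict_min[OF conv cont F_min])
  have domG: "effdom (conjugate_fun G) = UNIV"
    using N.conjugate_G_finite by (simp add: effdom_def GN)
  have domF: "effdom F = UNIV" by (simp add: effdom_def F)

  \<comment> \<open>By the chain rule, first-order optimality of \<open>\<beta>\<close> says that it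
    minimizes the tilt of \<open>G\<close> by \<open>transpose X *v \<zeta>\<close>; both conjugates
    can then be evaluated and the duality gap is zero.\<close>
  have "GDERIV (\<lambda>\<beta>. \<phi> (X *v \<beta>)) \<beta> :> transpose X *v g z"
    unfolding z_def by (rule GDERIV_matrix_compose[OF g])
  then have "\<beta> \<in> minimizers (tilt G (- (transpose X *v g z)))"
    by (rule minimizer_of_sum_minimizes_tilt[OF Gprops(3,1)]) (use \<beta> r \<Phi> in simp_all)
  moreover have "- (transpose X *v g z) = transpose X *v \<zeta>"
    unfolding \<zeta>_def by (rule linear_neg[OF matrix_vector_mul_linear, symmetric])
  ultimately have conjG: "conjugate_fun G (transpose X *v \<zeta>) = ereal (\<zeta> \<bullet> z - r)"
    using conjugate_eq_at_minimizer[of \<beta> G _ r] r by (simp add: dot_lmul_matrix z_def)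
  have conjF: "conjugate_fun F (- \<zeta>) = ereal (- (\<zeta> \<bullet> z) - \<phi> z)"
    using conjugate_eq_at_minimizer[of z F "- \<zeta>" "\<phi> z"] F_minimizers by (simp add: F)
  have strong: "\<Psi> \<zeta> = \<Phi> \<beta>"
    unfolding \<Psi>_def dual_obj_def conjG conjF \<Phi> r by (simp add: z_def)
  have weak: "\<Psi> \<zeta>' \<le> \<Phi> \<beta>'" for \<zeta>' \<beta>'
    unfolding \<Psi>_def \<Phi>_def by (rule weak_duality[OF Fprops(1) Gprops(1)])
  have "maximizers \<Psi> = {\<zeta>}"
  proof (intro equalityI subsetI)
    fix \<zeta>' assume "\<zeta>' \<in> maximizers \<Psi>"
    then have "\<Phi> \<beta> \<le> \<Psi> \<zeta>'" unfolding strong[symmetric] by (simp add: maximizers_def)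
    then show "\<zeta>' \<in> {\<zeta>}"
      using dual_optimal_eq_neg_gradient[where G = G and \<beta> = \<beta>, OF conv g r, of X \<zeta>']
      unfolding \<Phi>_def \<Psi>_def F by (simp add: \<zeta>_def z_def)
  next
    fix \<zeta>' assume "\<zeta>' \<in> {\<zeta>}"
    then show "\<zeta>' \<in> maximizers \<Psi>" using weak[of _ \<beta>] by (simp add: maximizers_def strong)
  qed

  have "effdom \<Phi> = effdom G"
  proof -
    have "\<Phi> b < \<infinity> \<longleftrightarrow> G b < \<infinity>" for b by (cases "G b") (auto simp: \<Phi>)
    then show ?thesis by (simp add: effdom_def)
  qed
  moreover have riG: "rel_interior (effdom G) \<noteq> {}"
    using N.convex_effdom_G N.zero_in_effdom rel_interior_eq_empty unfolding GN by blast
  ultimately have ri\<Phi>: "rel_interior (effdom \<Phi>) \<noteq> {}" by simp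
  have "interior {\<zeta>. \<Psi> \<zeta> > -\<infinity>} \<noteq> {}"
  proof -
    have "\<Psi> \<zeta>' > -\<infinity>" if "- \<zeta>' \<in> effdom (conjugate_fun F)" for \<zeta>'
    proof -
      have "conjugate_fun F (- \<zeta>') < \<infinity>" "conjugate_fun G (transpose X *v \<zeta>') < \<infinity>"
        using that domG by (auto simp: effdom_def)
      then show ?thesis
        unfolding \<Psi>_def dual_obj_def
        by (cases "conjugate_fun F (- \<zeta>')"; cases "conjugate_fun G (transpose X *v \<zeta>')") auto
    qed
    \<comment> \<open>As the conjugate of \<open>G\<close> is finite everywhere, the domain of
      \<open>\<Psi>\<close> contains the reflection of the domain of the conjugate of
      \<open>F\<close>.\<close>
    then have "uminus -` interior (effdom (conjugate_fun F)) \<subseteq> {\<zeta>. \<Psi> \<zeta> > -\<infinity>}"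
      using interior_subset by auto
    moreover have "open (uminus -` interior (effdom (conjugate_fun F)))"
      by (intro open_vimage open_interior continuous_intros)
    moreover have "\<zeta> \<in> uminus -` interior (effdom (conjugate_fun F))" using intF by simp
    ultimately show ?thesis using interior_maximal by blast
  qed
  moreover have "firmly_convex_rel F (- \<zeta>)"
    using \<open>firmly_convex F\<close> F_minimizers by (simp add: firmly_convex_def subdiff_zeros_eq_minimizers)
  moreover have "polyhedron (subdiff (conjugate_fun F) (- \<zeta>))"
    using subdiff_conjugate_eq_minimizers[OF Fprops] conjF F_minimizers
    by (simp add: polytope_imp_polyhedron polytope_sing)
  moreover have "polyhedron (subdiff (conjugate_fun G) (transpose X *v \<zeta>))"
    using subdiff_conjugate_eq_minimizers[OF Gprops] N.conjugate_G_finite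
      N.polyhedron_minimizers_tilt_G by (simp add: GN)
  \<comment> \<open>For (B), any point of the relative interior serves as \<open>\<beta>s\<close>
    and \<open>\<zeta>\<close> itself as \<open>\<zeta>s\<close>.\<close>
  ultimately show ?thesis
    using assms(13,14) Fprops Gprops no_affine_lines_of_strictly_convex[OF assms(13)]
      N.no_affine_lines_G[folded GN] ri\<Phi> riG intF domG domF compact_min \<open>maximizers \<Psi> = {\<zeta>}\<close>
      N.firmly_convex_rel_G[folded GN]
    by auto
qed

end
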